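(* There exists a homeomorphism $f:\mathbb{T}^2\to\mathbb{T}^2$ that is area-preserving, transitive and annular, and is an irrational pseudo-rotation with uniformly bounded deviations, but which is not semiconjugate to any irrational rotation $R_\alpha$, $\alpha\in\mathbb{R}\setminus\mathbb{Q}$, of the circle $\mathbb{T}^1$.
   Context: $\mathbb{T}^1=\mathbb{R}/\mathbb{Z}$, $\mathbb{T}^2=\mathbb{R}^2/\mathbb{Z}^2$, and $R_\alpha:\mathbb{T}^1\to\mathbb{T}^1$ is $x\mapsto x+\alpha\bmod 1$. Area-preserving means preserving Lebesgue measure; transitive means having a dense forward orbit. A lift of a homeomorphism $f$ of $\mathbb{T}^2$ is a homeomorphism $F$ of $\mathbb{R}^2$ with $\pi\circ F=f\circ\pi$, where $\pi:\mathbb{R}^2\to\mathbb{T}^2$ is the covering projection. $f$ is annular if there exist $M>0$, a nonzero $v\in\mathbb{Z}^2$ and a lift $F$ of $f$ such that $|\langle F^n(x)-x,v\rangle|<M$ for all $x\in\mathbb{R}^2$, $n\in\mathbb{N}$. $f$ is a pseudo-rotation with uniformly bounded deviations if it is homotopic to the identity and there exist a lift $F$, $\rho\in\mathbb{R}^2$ and $C>0$ with $|F^n(z)-z-n\rho|\le C$ for all $n\in\mathbb{N}$, $z\in\mathbb{R}^2$; it is called irrational if $\rho\notin\mathbb{Q}^2$. $f$ is semiconjugate to $R_\alpha$ if there is a continuous surjective $h:\mathbb{T}^2\to\mathbb{T}^1$ with $h\circ f=R_\alpha\circ h$. *)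

theory Defs
  imports "HOL-Analysis.Analysis"
begin

definition int_lattice :: "'a::euclidean_space set" where
  "int_lattice = {x. \<forall>b\<in>Basis. x \<bullet> b \<in> \<int>}"

definition rat_vectors :: "'a::euclidean_space set" where
  "rat_vectors = {x. \<forall>b\<in>Basis. x \<bullet> b \<in> \<rat>}"

definition torus_rel :: "'a::euclidean_space \<Rightarrow> 'a \<Rightarrow> bool" where
  "torus_rel x y \<longleftrightarrow> x - y \<in> int_lattice"

lemma equivp_torus_rel: "equivp torus_rel"
proof (rule equivpI)
  show "reflp torus_rel"
    by (auto simp: reflp_def torus_rel_def int_lattice_def)
  show "symp torus_rel"
    unfolding symp_def torus_rel_def int_lattice_def
    by (auto simp: inner_diff_left) (metis Ints_minus minus_diff_eq)
  show "transp torus_rel"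
    unfolding transp_def torus_rel_def int_lattice_def
    by (auto simp: inner_diff_left) (metis Ints_add diff_add_cancel add_diff_eq)
qed

quotient_type (overloaded) 'a torus = "'a::euclidean_space" / torus_rel
  by (rule equivp_torus_rel)

text \<open>The torus \<open>V / Z\<^sup>d\<close> of a Euclidean space \<open>V\<close> of dimension \<open>d\<close>: the circle is
  \<^typ>\<open>real torus\<close>, and the two-dimensional torus is \<^typ>\<open>(real^2) torus\<close>.\<close>

lift_definition torus_proj :: "'a::euclidean_space \<Rightarrow> 'a torus" is "\<lambda>x. x" .

instantiation torus :: (euclidean_space) topological_space
begin

definition open_torus :: "'a torus set \<Rightarrow> bool" where
  "open_torus U \<longleftrightarrow> open (torus_proj -` U)"

instance
  by standard (auto simp: open_torus_def vimage_Union)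

end

lemma continuous_on_torus_proj: "continuous_on UNIV torus_proj"
  by (simp add: continuous_on_open_vimage open_torus_def)

lemma torus_proj_eq_iff: "torus_proj x = torus_proj y \<longleftrightarrow> x - y \<in> int_lattice"
  by transfer (simp add: torus_rel_def)

lemma surj_torus_proj: "surj torus_proj"
  unfolding surj_def by transfer (metis equivp_reflp equivp_torus_rel)

definition unit_cell :: "'a::euclidean_space set" where
  "unit_cell = {x. \<forall>b\<in>Basis. 0 \<le> x \<bullet> b \<and> x \<bullet> b < 1}"

lemma bij_betw_torus_proj_unit_cell: "bij_betw torus_proj unit_cell UNIV"
proof (rule bij_betwI')
  fix x y :: 'a
  assume x: "x \<in> unit_cell" and y: "y \<in> unit_cell"
  have "x = y" if d: "x - y \<in> int_lattice"
  proof (rule euclidean_eqI)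
    fix b :: 'a
    assume b: "b \<in> Basis"
    with d have "x \<bullet> b - y \<bullet> b \<in> \<int>"
      by (simp add: int_lattice_def inner_diff_left)
    then obtain k where k: "x \<bullet> b - y \<bullet> b = of_int k"
      by (rule Ints_cases)
    have "0 \<le> x \<bullet> b" "x \<bullet> b < 1" "0 \<le> y \<bullet> b" "y \<bullet> b < 1"
      using x y b by (auto simp: unit_cell_def)
    with k have "of_int k < (1::real)" "-1 < (of_int k :: real)" by linarith+
    then have "k = 0" by linarith
    with k show "x \<bullet> b = y \<bullet> b" by simp
  qed
  then show "torus_proj x = torus_proj y \<longleftrightarrow> x = y"
    by (auto simp: torus_proj_eq_iff int_lattice_def)
next
  fix t :: "'a torus"
  obtain x where x: "t = torus_proj x" using surj_torus_proj by blast
  define y where "y = (\<Sum>b\<in>Basis. frac (x \<bullet> b) *\<^sub>R b)"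
  have yb: "y \<bullet> b = frac (x \<bullet> b)" if "b \<in> Basis" for b
    using that by (simp add: y_def)
  have "y \<in> unit_cell" by (simp add: unit_cell_def yb frac_lt_1)
  moreover have "x - y \<in> int_lattice"
    by (simp add: int_lattice_def inner_diff_left yb frac_def)
  ultimately show "\<exists>y\<in>unit_cell. t = torus_proj y"
    using x by (auto simp: torus_proj_eq_iff)
qed auto

text \<open>Lebesgue measure on the torus, as a Borel measure: the image of Lebesgue measure on the
  half-open fundamental domain.\<close>

definition torus_measure :: "'a::euclidean_space torus measure" where
  "torus_measure = distr (restrict_space lborel unit_cell) borel torus_proj"

lemma unit_cell_sets [measurable]: "unit_cell \<in> sets borel"
  unfolding unit_cell_def by measurable

lemma torus_proj_measurable [measurable]: "torus_proj \<in> borel_measurable borel"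
  by (rule borel_measurable_continuous_onI[OF continuous_on_torus_proj])

lemma emeasure_torus_measure:
  fixes A :: "'a::euclidean_space torus set"
  assumes "A \<in> sets borel"
  shows "emeasure torus_measure A = emeasure lborel (torus_proj -` A \<inter> unit_cell)"
proof -
  have "torus_proj \<in> measurable (restrict_space lborel unit_cell) (borel :: 'a torus measure)"
    by (rule measurable_restrict_space1) simp
  then have "emeasure torus_measure A =
      emeasure (restrict_space lborel unit_cell) (torus_proj -` A \<inter> unit_cell)"
    using assms by (simp add: torus_measure_def emeasure_distr space_restrict_space)
  also have "\<dots> = emeasure lborel (torus_proj -` A \<inter> unit_cell)"
    by (rule emeasure_restrict_space) auto
  finally show ?thesis .
qed

definition torus_homeo :: "('a::euclidean_space torus \<Rightarrow> 'a torus) \<Rightarrow> bool" where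
  "torus_homeo f \<longleftrightarrow> (\<exists>g. homeomorphism UNIV UNIV f g)"

definition area_preserving :: "('a::euclidean_space torus \<Rightarrow> 'a torus) \<Rightarrow> bool" where
  "area_preserving f \<longleftrightarrow>
     f \<in> measurable borel borel \<and>
     (\<forall>A\<in>sets borel. emeasure torus_measure (f -` A) = emeasure torus_measure A)"

definition transitive_map :: "('a::topological_space \<Rightarrow> 'a) \<Rightarrow> bool" where
  "transitive_map f \<longleftrightarrow> (\<exists>x. closure {(f ^^ n) x |n. True} = UNIV)"

definition lift_of ::
  "('a::euclidean_space torus \<Rightarrow> 'a torus) \<Rightarrow> ('a \<Rightarrow> 'a) \<Rightarrow> bool" where
  "lift_of f F \<longleftrightarrow>
     (\<exists>G. homeomorphism UNIV UNIV F G) \<and> torus_proj \<circ> F = f \<circ> torus_proj"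

definition annular :: "('a::euclidean_space torus \<Rightarrow> 'a torus) \<Rightarrow> bool" where
  "annular f \<longleftrightarrow>
     (\<exists>M v F. M > 0 \<and> v \<in> int_lattice \<and> v \<noteq> 0 \<and> lift_of f F \<and>
        (\<forall>x n. \<bar>((F ^^ n) x - x) \<bullet> v\<bar> < M))"

definition pseudo_rotation_bounded_dev ::
  "('a::euclidean_space torus \<Rightarrow> 'a torus) \<Rightarrow> 'a \<Rightarrow> bool" where
  "pseudo_rotation_bounded_dev f \<rho> \<longleftrightarrow>
     homotopic_with_canon (\<lambda>_. True) UNIV UNIV id f \<and>
     (\<exists>F C. lift_of f F \<and> C > 0 \<and>
        (\<forall>n z. norm ((F ^^ n) z - z - real n *\<^sub>R \<rho>) \<le> C))"

text \<open>The vector \<open>\<rho>\<close> depends on the lift only up to an integer vector, so its irrationality is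
  a property of \<open>f\<close>.\<close>

definition irrational_pseudo_rotation_bounded_dev ::
  "('a::euclidean_space torus \<Rightarrow> 'a torus) \<Rightarrow> bool" where
  "irrational_pseudo_rotation_bounded_dev f \<longleftrightarrow>
     (\<exists>\<rho>. pseudo_rotation_bounded_dev f \<rho> \<and> \<rho> \<notin> rat_vectors)"

lift_definition circle_rotation :: "real \<Rightarrow> real torus \<Rightarrow> real torus" is "\<lambda>\<alpha> x. x + \<alpha>"
  by (simp add: torus_rel_def)

definition semiconjugate ::
  "('a::topological_space \<Rightarrow> 'a) \<Rightarrow> ('b::topological_space \<Rightarrow> 'b) \<Rightarrow> bool" where
  "semiconjugate f g \<longleftrightarrow> (\<exists>h. continuous_on UNIV h \<and> surj h \<and> h \<circ> f = g \<circ> h)"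

end

theory Submission imports Defs
begin

text \<open>
  The example is a map of the closed annulus, the quotient of the strip \<open>0 \<le> y \<le> 1\<close> by the
  horizontal integer translations, that rotates both boundary circles by the same irrational angle
  \<open>\<alpha>\<close>. The two circles are glued together to form the torus. The annulus map itself has the rotation
  by \<open>\<alpha>\<close> as a factor, through a continuous function \<open>c\<close> with \<open>c \<circ> F = c + \<alpha>\<close>; but the gluing is
  such that \<open>c\<close> equals \<open>x\<close> on the lower circle and \<open>x + s\<close> on the upper one, where \<open>s\<close> is
  irrational. So \<open>c\<close> does not descend to the torus.

  This already suffices (\<open>boundary_rigidity\<close>). Given a semiconjugacy to the rotation by \<open>\<beta>\<close>, let
  \<open>u\<close> be its composition with the lattice projection and with the embedding of the circle into the
  complex plane, so that \<open>u \<circ> F\<close> is \<open>u\<close> times the number \<open>e\<close> of modulus \<open>1\<close> and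
  argument \<open>2 \<pi> \<beta>\<close>. On the circle \<open>y = 0\<close> the map is the rotation by
  \<open>\<alpha>\<close>, so \<open>v(t) = u(t, 0)\<close> satisfies \<open>v(t + \<alpha>) = e v(t)\<close>. Hence \<open>u\<close> divided by \<open>v \<circ> c\<close> is
  invariant, and it is continuous on the open annulus. As some orbit is dense, it is
  constant. Its limits at the lower and the upper circle yield \<open>v(x) = v(x + s)\<close> for all \<open>x\<close>. As \<open>s\<close>
  is irrational, \<open>v\<close> is constant, thus \<open>e = 1\<close> and \<open>\<beta>\<close> is an integer. The same argument with
  \<open>u = 1\<close>, and a nonconstant function on the circle in place of \<open>v\<close> that the rotation by a rational
  \<open>\<alpha>\<close> would leave invariant, shows that \<open>\<alpha>\<close> is irrational. Bounded deviations hold because \<open>c\<close> is at bounded distance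
  from \<open>x\<close> and the strips are invariant; invariance of the strips also makes the map annular.

  The map \<open>F\<close> is built by fast approximation in the manner of Anosov and Katok (\<open>limit_map\<close>): it is
  the limit of \<open>F\<^sub>n = K\<^sub>n R\<^sub>n K\<^sub>n\<inverse>\<close>, where \<open>R\<^sub>n\<close> is the translation by \<open>(a\<^sub>n, 0)\<close> for a rational number \<open>a\<^sub>n\<close>
  with denominator \<open>q\<^sub>n\<close>, and \<open>K\<^sub>n\<^sub>+\<^sub>1\<close> is \<open>K\<^sub>n\<close> preceded by an area-preserving map that commutes with
  \<open>R\<^sub>n\<close>. This map twists a disc in each of many cells of width \<open>1/q\<^sub>n\<close> that span the height of the strip, and
  it makes the image of the line \<open>y = 1/2\<close> almost dense (\<open>twist_curve_dense\<close>). Then \<open>a\<^sub>n\<^sub>+\<^sub>1\<close> is taken so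
  close to \<open>a\<^sub>n\<close> that \<open>F\<^sub>n\<^sub>+\<^sub>1\<close> is close to \<open>F\<^sub>n\<close> (\<open>next_stage_exists\<close>), while an orbit of \<open>F\<^sub>n\<^sub>+\<^sub>1\<close> follows
  the almost dense curve (\<open>rot_conj_eps_transitive\<close>). The cells lean with the slope of the level lines of
  \<open>x + s y\<close>, and the twists change this function by at most \<open>1/q\<^sub>n\<close>; composed with \<open>K\<^sub>n\<inverse>\<close>, it
  therefore converges uniformly to \<open>c\<close>. Since each \<open>K\<^sub>n\<close> is the identity near the boundary
  circles, the boundary values of \<open>c\<close> are those of \<open>x + s y\<close>.
\<close>

section \<open>Lifts of torus maps\<close>

definition lattice_equivariant :: "('a::euclidean_space \<Rightarrow> 'a) \<Rightarrow> bool" where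
  "lattice_equivariant F \<longleftrightarrow> (\<forall>z. \<forall>k\<in>int_lattice. F (z + k) = F z + k)"

definition lebesgue_preserving :: "('a::euclidean_space \<Rightarrow> 'a) \<Rightarrow> bool" where
  "lebesgue_preserving F \<longleftrightarrow> F \<in> borel_measurable borel \<and>
     (\<forall>A\<in>sets borel. emeasure lborel (F -` A) = emeasure lborel A)"

lemma lebesgue_preservingD:
  "lebesgue_preserving F \<Longrightarrow> A \<in> sets borel \<Longrightarrow> emeasure lborel (F -` A) = emeasure lborel A"
  by (simp add: lebesgue_preserving_def)

definition torus_map :: "('a::euclidean_space \<Rightarrow> 'a) \<Rightarrow> 'a torus \<Rightarrow> 'a torus" where
  "torus_map F t = torus_proj (F (SOME z. torus_proj z = t))"

lemma int_lattice_add: "k \<in> int_lattice \<Longrightarrow> l \<in> int_lattice \<Longrightarrow> k + l \<in> int_lattice"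
  and int_lattice_diff: "k \<in> int_lattice \<Longrightarrow> l \<in> int_lattice \<Longrightarrow> k - l \<in> int_lattice"
  and int_lattice_minus: "k \<in> int_lattice \<Longrightarrow> - k \<in> int_lattice"
  by (auto simp: int_lattice_def inner_add_left inner_diff_left)

lemma torus_proj_add_lattice: "k \<in> int_lattice \<Longrightarrow> torus_proj (z + k) = torus_proj z"
  by (simp add: torus_proj_eq_iff)

lemma lattice_equivariantD:
  "lattice_equivariant F \<Longrightarrow> k \<in> int_lattice \<Longrightarrow> F (z + k) = F z + k"
  by (auto simp: lattice_equivariant_def)

lemma lattice_equivariant_proj:
  assumes "lattice_equivariant F" "torus_proj z = torus_proj w"
  shows "torus_proj (F z) = torus_proj (F w)"
proof -
  have "z - w \<in> int_lattice" using assms(2) by (simp add: torus_proj_eq_iff)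
  then have "F z = F w + (z - w)" using lattice_equivariantD[OF assms(1), of "z - w" w] by simp
  then show ?thesis using \<open>z - w \<in> int_lattice\<close> by (simp add: torus_proj_add_lattice)
qed

lemma torus_map_proj:
  assumes "lattice_equivariant F"
  shows "torus_map F (torus_proj z) = torus_proj (F z)"
  unfolding torus_map_def
  by (rule lattice_equivariant_proj[OF assms]) (rule someI, rule refl)

lemma continuous_torus_map:
  assumes "lattice_equivariant F" "continuous_on UNIV F"
  shows "continuous_on UNIV (torus_map F)"
proof -
  have "open (torus_map F -` U)" if "open U" for U
  proof -
    have "torus_proj -` (torus_map F -` U) = F -` (torus_proj -` U)"
      by (auto simp: torus_map_proj[OF assms(1)])
    then show ?thesis
      using that assms(2) by (simp add: open_torus_def continuous_on_open_vimage)
  qed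
  then show ?thesis by (simp add: continuous_on_open_vimage)
qed

lemma lattice_equivariant_inverse:
  assumes "lattice_equivariant F" "\<And>z. G (F z) = z" "\<And>z. F (G z) = z"
  shows "lattice_equivariant G"
  unfolding lattice_equivariant_def
proof (intro allI ballI)
  fix z k :: 'a assume "k \<in> int_lattice"
  then have "F (G z + k) = z + k" using assms by (simp add: lattice_equivariantD)
  then show "G (z + k) = G z + k" using assms(2) by metis
qed

lemma homeomorphism_torus_map:
  assumes "lattice_equivariant F" and FG: "homeomorphism UNIV UNIV F G"
  shows "homeomorphism UNIV UNIV (torus_map F) (torus_map G)"
proof -
  have inv: "G (F z) = z" "F (G z) = z" for z
    using FG by (auto simp: homeomorphism_def)
  have G: "lattice_equivariant G"
    by (rule lattice_equivariant_inverse[OF assms(1)]) (auto simp: inv)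
  have 1: "torus_map G (torus_map F t) = t" for t
    using surj_torus_proj[unfolded surj_def, rule_format, of t] assms(1) G
    by (auto simp: torus_map_proj inv)
  have 2: "torus_map F (torus_map G t) = t" for t
    using surj_torus_proj[unfolded surj_def, rule_format, of t] assms(1) G
    by (auto simp: torus_map_proj inv)
  show ?thesis
    unfolding homeomorphism_def
    using 1 2 FG assms(1) G by (auto simp: homeomorphism_def continuous_torus_map) (metis rangeI)+
qed

lemma lift_of_torus_map:
  assumes "lattice_equivariant F" "homeomorphism UNIV UNIV F G"
  shows "lift_of (torus_map F) F"
  using assms by (auto simp: lift_of_def torus_map_proj fun_eq_iff)

lemma torus_map_funpow:
  assumes "lattice_equivariant F"
  shows "(torus_map F ^^ n) (torus_proj z) = torus_proj ((F ^^ n) z)"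
  by (induction n) (auto simp: torus_map_proj[OF assms])

text \<open>The projection is open, since the saturation of a set is the union of its translates.\<close>
lemma open_torus_proj_image:
  assumes "open U"
  shows "open (torus_proj ` U)"
proof -
  have "torus_proj -` (torus_proj ` U) = (\<Union>k\<in>int_lattice. (\<lambda>x. x + k) ` U)" (is "?L = ?R")
  proof (intro equalityI subsetI)
    fix x assume "x \<in> ?L"
    then obtain u where "u \<in> U" "torus_proj x = torus_proj u" by auto
    then have "x - u \<in> int_lattice" "x = u + (x - u)" by (auto simp: torus_proj_eq_iff)
    with \<open>u \<in> U\<close> show "x \<in> ?R" by blast
  next
    fix x assume "x \<in> ?R"
    then show "x \<in> ?L" by (auto simp: torus_proj_add_lattice)
  qed
  moreover have "open ?R"
  proof (rule open_UN, rule ballI)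
    fix k :: 'a
    have "(\<lambda>x. x + k) ` U = (\<lambda>x. k + x) ` U" by (auto simp: add.commute)
    then show "open ((\<lambda>x. x + k) ` U)" using open_translation[OF assms, of k] by simp
  qed
  ultimately show ?thesis by (simp add: open_torus_def)
qed

text \<open>The straight-line homotopy between the identity and the lift is equivariant at every time.
  It descends continuously because the projection is open, so that its product with the identity
  of the interval is again a quotient map.\<close>
lemma homotopic_id_torus_map:
  fixes F :: "'a::euclidean_space \<Rightarrow> 'a"
  assumes eq: "lattice_equivariant F" and cont: "continuous_on UNIV F"
  shows "homotopic_with_canon (\<lambda>_. True) UNIV UNIV id (torus_map F)"
proof -
  define \<Phi> :: "real \<Rightarrow> 'a \<Rightarrow> 'a" where "\<Phi> = (\<lambda>t z. z + t *\<^sub>R (F z - z))"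
  have \<Phi>eq: "lattice_equivariant (\<Phi> t)" for t
    by (auto simp: lattice_equivariant_def \<Phi>_def lattice_equivariantD[OF eq])
  have \<Phi>cont: "continuous_on UNIV (\<lambda>p. \<Phi> (fst p) (snd p))"
    unfolding \<Phi>_def by (intro continuous_intros continuous_on_compose2[OF cont]) auto
  define h where "h = (\<lambda>p. torus_map (\<Phi> (fst p)) (snd p))"
  have "continuous_on UNIV h"
    unfolding continuous_on_open_vimage[OF open_UNIV]
  proof (intro allI impI)
    fix W :: "'a torus set" assume "open W"
    define V where "V = (\<lambda>p. \<Phi> (fst p) (snd p)) -` (torus_proj -` W)"
    have "open V"
      using \<open>open W\<close> \<Phi>cont unfolding V_def
      by (simp add: open_torus_def continuous_on_open_vimage)
    have *: "h -` W = map_prod id torus_proj ` V"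
    proof (intro equalityI subsetI)
      fix p assume p: "p \<in> h -` W"
      obtain z where "snd p = torus_proj z" using surj_torus_proj by blast
      with p have "(fst p, z) \<in> V" "p = map_prod id torus_proj (fst p, z)"
        by (auto simp: V_def h_def torus_map_proj[OF \<Phi>eq] prod_eq_iff)
      then show "p \<in> map_prod id torus_proj ` V" by blast
    qed (auto simp: V_def h_def torus_map_proj[OF \<Phi>eq])
    have "open (map_prod id torus_proj ` V)"
    proof (rule Topological_Spaces.openI)
      fix p assume "p \<in> map_prod id torus_proj ` V"
      then obtain t z where tz: "(t, z) \<in> V" "p = (t, torus_proj z)" by auto
      from open_prod_elim[OF \<open>open V\<close> tz(1)] obtain A B where
        AB: "open A" "open B" "(t, z) \<in> A \<times> B" "A \<times> B \<subseteq> V" by metis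
      then have "open (A \<times> torus_proj ` B)" by (intro open_Times open_torus_proj_image)
      moreover have "p \<in> A \<times> torus_proj ` B" using AB tz by auto
      moreover have "A \<times> torus_proj ` B \<subseteq> map_prod id torus_proj ` V"
      proof
        fix w assume "w \<in> A \<times> torus_proj ` B"
        then obtain a b where "w = map_prod id torus_proj (a, b)" "(a, b) \<in> A \<times> B" by auto
        then show "w \<in> map_prod id torus_proj ` V" using AB by blast
      qed
      ultimately show "\<exists>T. open T \<and> p \<in> T \<and> T \<subseteq> map_prod id torus_proj ` V" by blast
    qed
    then show "open (h -` W \<inter> UNIV)" using * by simp
  qed
  moreover have "h (0, t) = t" "h (1, t) = torus_map F t" for t
  proof -
    obtain z where z: "t = torus_proj z" using surj_torus_proj by blast
    show "h (0, t) = t" "h (1, t) = torus_map F t"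
      unfolding z h_def using eq by (simp_all add: torus_map_proj \<Phi>eq) (simp_all add: \<Phi>_def)
  qed
  moreover have "prod_topology (top_of_set {0..1::real}) (top_of_set (UNIV::'a torus set)) =
      top_of_set ({0..1} \<times> UNIV)"
    by (rule prod_topology_subtopology_eu)
  ultimately show ?thesis
    unfolding homotopic_with_def
    by (intro exI[of _ h]) (auto intro: continuous_on_subset[of UNIV h] simp del: subtopology_UNIV)
qed

section \<open>Countable partitions and fundamental domains\<close>

lemma lebesgue_preserving_translation: "lebesgue_preserving (\<lambda>x. x + c)"
  unfolding lebesgue_preserving_def
proof (intro conjI ballI)
  show m: "(\<lambda>x. x + c) \<in> borel_measurable borel" by measurable
  fix A :: "'a set" assume "A \<in> sets borel"
  then show "emeasure lborel ((\<lambda>x. x + c) -` A) = emeasure lborel A"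
    by (subst (2) lborel_distr_plus[of c, symmetric])
       (auto simp: emeasure_distr add.commute intro!: arg_cong[where f="emeasure lborel"])
qed

lemma emeasure_countable_partition:
  assumes "countable I" "disjoint_family_on C I" "\<And>i. i \<in> I \<Longrightarrow> C i \<in> sets M"
    "(\<Union>i\<in>I. C i) = space M" "A \<in> sets M"
  shows "emeasure M A = (\<integral>\<^sup>+i. emeasure M (A \<inter> C i) \<partial>count_space I)"
proof -
  have "A = (\<Union>i\<in>I. A \<inter> C i)" using assms(4) sets.sets_into_space[OF assms(5)] by auto
  then have "emeasure M A = emeasure M (\<Union>i\<in>I. A \<inter> C i)" by simp
  also have "\<dots> = (\<integral>\<^sup>+i. emeasure M (A \<inter> C i) \<partial>count_space I)"
    by (rule emeasure_UN_countable)
       (use assms in \<open>auto simp: disjoint_family_on_def intro!: sets.Int\<close>)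
  finally show ?thesis .
qed

lemma countable_int_lattice: "countable (int_lattice :: 'a::euclidean_space set)"
proof -
  have "inj_on (\<lambda>x. \<lambda>b\<in>Basis. x \<bullet> b) (int_lattice :: 'a set)"
    by (rule inj_onI, rule euclidean_eqI) (metis restrict_apply')
  moreover have "countable ((\<lambda>x. \<lambda>b\<in>Basis. x \<bullet> b) ` (int_lattice :: 'a set))"
  proof (rule countable_subset)
    show "(\<lambda>x. \<lambda>b\<in>Basis. x \<bullet> b) ` (int_lattice :: 'a set) \<subseteq> (\<Pi>\<^sub>E b\<in>Basis. (\<int>::real set))"
      by (auto simp: int_lattice_def)
    show "countable (\<Pi>\<^sub>E b\<in>(Basis :: 'a set). (\<int>::real set))"
      by (rule countable_PiE) (auto simp: Ints_def)
  qed
  ultimately show ?thesis by (rule countable_image_inj_on[rotated])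
qed

lemma unit_cell_translates:
  shows "disjoint_family_on (\<lambda>k. (\<lambda>x. x - k) -` unit_cell) (int_lattice :: 'a::euclidean_space set)"
    and "(\<Union>k\<in>int_lattice. (\<lambda>x. x - k) -` unit_cell) = (UNIV :: 'a set)"
proof -
  show "disjoint_family_on (\<lambda>k. (\<lambda>x. x - k) -` unit_cell) (int_lattice :: 'a set)"
    unfolding disjoint_family_on_def
  proof (intro ballI impI equals0I)
    fix k l x :: 'a
    assume kl: "k \<in> int_lattice" "l \<in> int_lattice" "k \<noteq> l"
      and "x \<in> (\<lambda>x. x - k) -` unit_cell \<inter> (\<lambda>x. x - l) -` unit_cell"
    then have "x - k \<in> unit_cell" "x - l \<in> unit_cell" by auto
    moreover have "torus_proj (x - k) = torus_proj (x - l)"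
      using kl by (simp add: torus_proj_eq_iff int_lattice_diff)
    ultimately have "x - k = x - l"
      by (rule inj_onD[OF bij_betw_imp_inj_on[OF bij_betw_torus_proj_unit_cell], rotated 1])
    with kl show False by simp
  qed
  show "(\<Union>k\<in>int_lattice. (\<lambda>x. x - k) -` unit_cell) = (UNIV :: 'a set)"
  proof (intro equalityI subsetI UNIV_I)
    fix x :: 'a
    obtain y where y: "y \<in> unit_cell" "torus_proj x = torus_proj y"
      using bij_betw_torus_proj_unit_cell by (metis UNIV_I bij_betw_def imageE)
    then have "x - y \<in> int_lattice" by (simp add: torus_proj_eq_iff)
    then show "x \<in> (\<Union>k\<in>int_lattice. (\<lambda>x. x - k) -` unit_cell)" using y by force
  qed
qed

text \<open>Cut the second fundamental domain along the first and translate the pieces back.\<close>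
lemma emeasure_fundamental_domain:
  fixes B D :: "'a::euclidean_space set"
  assumes B: "B \<in> sets borel" "\<And>x k. k \<in> int_lattice \<Longrightarrow> x + k \<in> B \<longleftrightarrow> x \<in> B"
    and D: "D \<in> sets borel" "disjoint_family_on (\<lambda>k. (\<lambda>x. x - k) -` D) int_lattice"
      "(\<Union>k\<in>int_lattice. (\<lambda>x. x - k) -` D) = UNIV"
  shows "emeasure lborel (B \<inter> D) = emeasure lborel (B \<inter> unit_cell)"
proof -
  have sets: "(\<lambda>x. x - k) -` E \<in> sets borel" if "E \<in> sets borel" for k and E :: "'a set"
  proof -
    have "(\<lambda>x::'a. x - k) \<in> borel_measurable borel" by measurable
    from measurable_sets[OF this that] show ?thesis by simp
  qed
  have "emeasure lborel (B \<inter> D) =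
      (\<integral>\<^sup>+k. emeasure lborel (B \<inter> D \<inter> (\<lambda>x. x - k) -` unit_cell) \<partial>count_space int_lattice)"
    by (rule emeasure_countable_partition)
       (use B D unit_cell_translates in \<open>auto simp: countable_int_lattice sets unit_cell_sets\<close>)
  also have "\<dots> = (\<integral>\<^sup>+k. emeasure lborel (B \<inter> unit_cell \<inter> (\<lambda>x. x - (-k)) -` D) \<partial>count_space int_lattice)"
  proof (rule nn_integral_cong)
    fix k :: 'a assume "k \<in> space (count_space int_lattice)"
    then have k: "k \<in> int_lattice" by simp
    have m: "B \<inter> D \<inter> (\<lambda>x. x - k) -` unit_cell \<in> sets borel"
      using B D sets[OF unit_cell_sets] by auto
    have "emeasure lborel (B \<inter> D \<inter> (\<lambda>x. x - k) -` unit_cell) =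
        emeasure lborel ((\<lambda>x. x + k) -` (B \<inter> D \<inter> (\<lambda>x. x - k) -` unit_cell))"
      by (rule lebesgue_preservingD[OF lebesgue_preserving_translation m, symmetric])
    also have "(\<lambda>x. x + k) -` (B \<inter> D \<inter> (\<lambda>x. x - k) -` unit_cell) =
        B \<inter> unit_cell \<inter> (\<lambda>x. x - (-k)) -` D"
      using B(2)[OF k] by auto
    finally show "emeasure lborel (B \<inter> D \<inter> (\<lambda>x. x - k) -` unit_cell) =
        emeasure lborel (B \<inter> unit_cell \<inter> (\<lambda>x. x - (-k)) -` D)" .
  qed
  also have "\<dots> = (\<integral>\<^sup>+k. emeasure lborel (B \<inter> unit_cell \<inter> (\<lambda>x. x - k) -` D) \<partial>count_space int_lattice)"
    by (rule nn_integral_bij_count_space[of uminus])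
       (auto intro!: bij_betwI[where g=uminus] int_lattice_minus)
  also have "\<dots> = emeasure lborel (B \<inter> unit_cell)"
    by (rule emeasure_countable_partition[symmetric])
       (use B D unit_cell_sets in \<open>auto simp: countable_int_lattice sets\<close>)
  finally show ?thesis .
qed

text \<open>The preimage of the unit cell under the inverse of the lift is another fundamental
  domain, and a periodic set meets any two fundamental domains in the same measure.\<close>
lemma area_preserving_torus_map:
  assumes eq: "lattice_equivariant F" and FG: "homeomorphism UNIV UNIV F G"
    and mp: "lebesgue_preserving F"
  shows "area_preserving (torus_map F)"
  unfolding area_preserving_def
proof (intro conjI ballI)
  have inv: "G (F z) = z" "F (G z) = z" for z
    using FG by (auto simp: homeomorphism_def)
  have cont: "continuous_on UNIV F" "continuous_on UNIV G"
    using FG by (auto simp: homeomorphism_def)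
  have Geq: "lattice_equivariant G"
    by (rule lattice_equivariant_inverse[OF eq]) (auto simp: inv)
  show meas: "torus_map F \<in> borel_measurable borel"
    by (rule borel_measurable_continuous_onI[OF continuous_torus_map[OF eq cont(1)]])
  fix A :: "'a torus set" assume A: "A \<in> sets borel"
  define B where "B = torus_proj -` A"
  define D where "D = G -` unit_cell"
  have B: "B \<in> sets borel"
    unfolding B_def using measurable_sets[OF torus_proj_measurable A] by simp
  have D: "D \<in> sets borel"
    unfolding D_def
    using measurable_sets[OF borel_measurable_continuous_onI[OF cont(2)] unit_cell_sets] by simp
  have trD: "(\<lambda>x. x - k) -` D = G -` ((\<lambda>x. x - k) -` unit_cell)" if "k \<in> int_lattice" for k
  proof -
    have "G (x - k) = G x - k" for x
      using lattice_equivariantD[OF Geq int_lattice_minus[OF that], of x] by simp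
    then show ?thesis by (auto simp: D_def)
  qed
  have "torus_map F -` A \<in> sets borel" using measurable_sets[OF meas A] by simp
  then have "emeasure torus_measure (torus_map F -` A) =
      emeasure lborel (torus_proj -` (torus_map F -` A) \<inter> unit_cell)"
    by (rule emeasure_torus_measure)
  also have "torus_proj -` (torus_map F -` A) \<inter> unit_cell = F -` (B \<inter> D)"
    by (auto simp: B_def D_def torus_map_proj[OF eq] inv)
  also have "emeasure lborel \<dots> = emeasure lborel (B \<inter> D)"
    by (rule lebesgue_preservingD[OF mp]) (use B D in auto)
  also have "\<dots> = emeasure lborel (B \<inter> unit_cell)"
  proof (rule emeasure_fundamental_domain[OF B _ D])
    show "x + k \<in> B \<longleftrightarrow> x \<in> B" if "k \<in> int_lattice" for x k
      by (simp add: B_def torus_proj_add_lattice[OF that])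
    show "disjoint_family_on (\<lambda>k. (\<lambda>x. x - k) -` D) int_lattice"
      using unit_cell_translates(1) by (fastforce simp: disjoint_family_on_def trD)
    have "(\<Union>k\<in>int_lattice. (\<lambda>x. x - k) -` D) = G -` (\<Union>k\<in>int_lattice. (\<lambda>x. x - k) -` unit_cell)"
      by (simp add: trD vimage_UN)
    then show "(\<Union>k\<in>int_lattice. (\<lambda>x. x - k) -` D) = UNIV"
      by (simp only: unit_cell_translates(2) vimage_UNIV)
  qed
  also have "\<dots> = emeasure torus_measure A"
    using emeasure_torus_measure[OF A] by (simp add: B_def)
  finally show "emeasure torus_measure (torus_map F -` A) = emeasure torus_measure A" .
qed

text \<open>Density is stated upstairs, up to lattice translations, which avoids a metric on the torus.\<close>
lemma transitive_torus_map:
  assumes eq: "lattice_equivariant F"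
    and dense: "\<And>w e. 0 < e \<Longrightarrow> \<exists>j. \<exists>k\<in>int_lattice. dist ((F ^^ j) z + k) w < e"
  shows "transitive_map (torus_map F)"
  unfolding transitive_map_def
proof (intro exI[of _ "torus_proj z"] equalityI subsetI UNIV_I)
  fix t :: "'a torus"
  obtain w where w: "t = torus_proj w" using surj_torus_proj by blast
  show "t \<in> closure {(torus_map F ^^ n) (torus_proj z) |n. True}"
    unfolding closure_iff_nhds_not_empty
  proof (intro allI impI)
    fix A U assume "U \<subseteq> A" "open U" "t \<in> U"
    then have "open (torus_proj -` U)" "w \<in> torus_proj -` U"
      by (auto simp: open_torus_def w)
    then obtain e where e: "0 < e" "ball w e \<subseteq> torus_proj -` U" by (rule openE)
    obtain j k where jk: "k \<in> int_lattice" "dist ((F ^^ j) z + k) w < e"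
      using dense[OF e(1)] by blast
    then have "(F ^^ j) z + k \<in> torus_proj -` U" using e by (auto simp: dist_commute)
    then have "(torus_map F ^^ j) (torus_proj z) \<in> U"
      using jk by (simp add: torus_map_funpow[OF eq] torus_proj_add_lattice)
    then show "{(torus_map F ^^ n) (torus_proj z) |n. True} \<inter> A \<noteq> {}"
      using \<open>U \<subseteq> A\<close> by blast
  qed
qed

section \<open>Area-preserving twists of the plane\<close>

lemma lebesgue_preserving_openI:
  fixes f :: "'a::euclidean_space \<Rightarrow> 'a"
  assumes f: "f \<in> borel_measurable borel"
    and eq: "\<And>U. open U \<Longrightarrow> emeasure lborel U \<noteq> \<infinity> \<Longrightarrow> emeasure lborel (f -` U) = emeasure lborel U"
  shows "lebesgue_preserving f"
proof -
  have "lborel = distr lborel borel f"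
  proof (rule lborel_eqI)
    fix l u :: 'a assume "\<And>b. b \<in> Basis \<Longrightarrow> l \<bullet> b \<le> u \<bullet> b"
    then show "emeasure (distr lborel borel f) (box l u) = (\<Prod>b\<in>Basis. (u - l) \<bullet> b)"
      using f eq[of "box l u"] emeasure_lborel_box_finite[of l u]
      by (simp add: emeasure_distr less_top open_box)
  qed simp
  then have "emeasure lborel A = emeasure (distr lborel borel f) A" for A by simp
  then show ?thesis
    unfolding lebesgue_preserving_def using f by (simp add: emeasure_distr)
qed

lemma lebesgue_preserving_jacobian:
  fixes f g :: "real^'n::{finite,wellorder} \<Rightarrow> real^'n::_"
  assumes inv: "\<And>z. g (f z) = z" "\<And>z. f (g z) = z" and f: "continuous_on UNIV f"
    and g: "\<And>z. (g has_derivative g' z) (at z)" "\<And>z. \<bar>det (matrix (g' z))\<bar> = 1"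
  shows "lebesgue_preserving f"
proof (rule lebesgue_preserving_openI)
  show "f \<in> borel_measurable borel" by (rule borel_measurable_continuous_onI[OF f])
  fix U :: "(real^'n::_) set" assume U: "open U" "emeasure lborel U \<noteq> \<infinity>"
  then have Ul: "U \<in> lmeasurable"
    by (simp add: fmeasurableI less_top)
  have fU: "f -` U = g ` U" by (auto simp: image_iff inv) (metis inv(1))
  have int: "(\<lambda>x. \<bar>det (matrix (g' x))\<bar>) integrable_on U"
    using Ul by (simp add: g lmeasurable_iff_integrable_on)
  have inj: "inj_on g U" by (rule inj_on_inverseI[of _ f]) (simp add: inv)
  have der: "(g has_derivative g' x) (at x within U)" for x by (rule has_derivative_at_withinI[OF g(1)])
  have gl: "g ` U \<in> lmeasurable"
    using measurable_differentiable_image_eq[OF _ der inj] int Ul by auto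
  have "measure lebesgue (g ` U) = measure lebesgue U"
    using measure_differentiable_image_eq[OF _ der inj int] Ul by (simp add: g lmeasure_integral)
  then have "emeasure lebesgue (g ` U) = emeasure lebesgue U"
    using gl Ul by (simp add: emeasure_eq_measure2)
  moreover have "open (g ` U)" using U f by (simp flip: fU add: continuous_on_open_vimage)
  ultimately show "emeasure lborel (f -` U) = emeasure lborel U"
    using U by (simp add: fU)
qed

text \<open>The squared positive part makes the twist differentiable across the boundary of its disc.\<close>
lemma DERIV_max_0_power2: "((\<lambda>t::real. (max 0 t)^2) has_real_derivative 2 * max 0 t) (at t)"
proof -
  consider "t > 0" | "t < 0" | "t = 0" by linarith
  then show ?thesis
  proof cases
    case 1
    have "((\<lambda>t::real. t^2) has_real_derivative 2 * max 0 t) (at t)"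
      using 1 by (auto intro!: derivative_eq_intros)
    then show ?thesis
      by (rule DERIV_cong_ev[THEN iffD1, rotated 3])
         (use 1 in \<open>auto intro: eventually_mono[OF eventually_nhds_in_open[of "{0<..}" t]]\<close>)
  next
    case 2
    have "((\<lambda>t::real. 0) has_real_derivative 2 * max 0 t) (at t)"
      using 2 by (auto intro!: derivative_eq_intros)
    then show ?thesis
      by (rule DERIV_cong_ev[THEN iffD1, rotated 3])
         (use 2 in \<open>auto intro: eventually_mono[OF eventually_nhds_in_open[of "{..<0}" t]]\<close>)
  next
    case 3
    have "((\<lambda>h::real. ((max 0 h)^2) / h) \<longlongrightarrow> 0) (at 0)"
    proof (rule Lim_null_comparison)
      show "\<forall>\<^sub>F h in at 0. norm ((max 0 h)^2 / h) \<le> \<bar>h::real\<bar>"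
        by (auto simp: eventually_at_filter max_def power2_eq_square)
      show "((\<lambda>h::real. \<bar>h\<bar>) \<longlongrightarrow> 0) (at 0)" by (rule tendsto_rabs_zero) (rule tendsto_ident_at)
    qed
    then show ?thesis using 3 by (simp add: DERIV_def)
  qed
qed

text \<open>Rotation of each circle about the origin by an angle that depends on its radius. This is
  the basic area-preserving map: a twist supported in a disc which turns a horizontal diameter
  into a vertical one.\<close>
definition disc_twist :: "(real \<Rightarrow> real) \<Rightarrow> complex \<Rightarrow> complex" where
  "disc_twist \<theta> w = w * cis (\<theta> ((cmod w)\<^sup>2))"

text \<open>The linear change of coordinates \<open>(x, y) \<mapsto> (q (x + s y), y)\<close>, with values in the
  complex plane, and its inverse below. It squeezes the disc of a twist into an ellipse of width
  of order \<open>1/q\<close>, leaning with slope determined by \<open>s\<close>.\<close>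
definition shear_coord :: "real \<Rightarrow> nat \<Rightarrow> real^2 \<Rightarrow> complex" where
  "shear_coord s q z = Complex (real q * (z$1 + s * z$2)) (z$2)"

definition shear_vec :: "real \<Rightarrow> nat \<Rightarrow> complex \<Rightarrow> real^2" where
  "shear_vec s q w = vector [Re w / real q - s * Im w, Im w]"

definition plane_twist :: "real \<Rightarrow> nat \<Rightarrow> (real \<Rightarrow> real) \<Rightarrow> real^2 \<Rightarrow> real^2" where
  "plane_twist s q \<theta> z = shear_vec s q (disc_twist \<theta> (shear_coord s q z))"

lemma cmod_disc_twist [simp]: "cmod (disc_twist \<theta> w) = cmod w"
  by (simp add: disc_twist_def norm_mult)

lemma disc_twist_inverse [simp]: "disc_twist (\<lambda>t. - \<theta> t) (disc_twist \<theta> w) = w"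
  by (simp add: disc_twist_def norm_mult cis_mult mult.assoc)

lemma disc_twist_inverse' [simp]: "disc_twist \<theta> (disc_twist (\<lambda>t. - \<theta> t) w) = w"
  by (simp add: disc_twist_def norm_mult cis_mult mult.assoc)

lemma shear_coord_vec: "q > 0 \<Longrightarrow> shear_coord s q (shear_vec s q w) = w"
  by (simp add: shear_coord_def shear_vec_def complex_eq_iff)

lemma shear_vec_coord: "q > 0 \<Longrightarrow> shear_vec s q (shear_coord s q z) = z"
  by (simp add: shear_coord_def shear_vec_def vec_eq_iff forall_2)

lemma plane_twist_inverse: "q > 0 \<Longrightarrow> plane_twist s q \<theta> (plane_twist s q (\<lambda>t. - \<theta> t) z) = z"
  by (simp add: plane_twist_def shear_coord_vec shear_vec_coord)

lemma has_derivative_vec2I: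
  fixes f :: "'a::real_normed_vector \<Rightarrow> real^2"
  assumes "((\<lambda>x. f x $ 1) has_derivative (\<lambda>x. f' x $ 1)) (at a within S)"
    "((\<lambda>x. f x $ 2) has_derivative (\<lambda>x. f' x $ 2)) (at a within S)"
  shows "(f has_derivative f') (at a within S)"
proof -
  have "((\<lambda>x. f x $ i) has_derivative (\<lambda>x. f' x $ i)) (at a within S)" for i
    using assms exhaust_2[of i] by auto
  then show ?thesis
    by (subst has_derivative_componentwise_within) (auto simp: Basis_vec_def inner_axis)
qed

text \<open>The rotation angle depends on the squared radius alone, and its differential vanishes along
  the circles on which the twist moves points; therefore it does not contribute to the Jacobian.\<close>
lemma plane_twist_derivative:
  assumes q: "q > 0" and th: "\<And>t. (\<theta> has_real_derivative \<theta>' t) (at t)"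
  shows "\<exists>D. (plane_twist s q \<theta> has_derivative D) (at z) \<and> det (matrix D) = 1"
proof -
  define A where "A = (\<lambda>z::real^2. real q * (z$1 + s * z$2))"
  define T where "T = (\<lambda>z. \<theta> ((A z)^2 + (z$2)^2))"
  define t where "t = \<theta>' ((A z)^2 + (z$2)^2)"
  define W1 where "W1 = (\<lambda>z. A z * cos (T z) - z$2 * sin (T z))"
  define W2 where "W2 = (\<lambda>z. A z * sin (T z) + z$2 * cos (T z))"
  define T' where "T' = (\<lambda>d. (2 * A z * A d + 2 * z$2 * d$2) * t)"
  define W1' where "W1' = (\<lambda>d. A d * cos (T z) - d$2 * sin (T z) - W2 z * T' d)"
  define W2' where "W2' = (\<lambda>d. A d * sin (T z) + d$2 * cos (T z) + W1 z * T' d)"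
  define D where "D = (\<lambda>d. vector [W1' d / real q - s * W2' d, W2' d] :: real^2)"
  have nth: "((\<lambda>z. z$i) has_derivative (\<lambda>d. d$i)) (at z)" for i :: 2
    by (rule bounded_linear.has_derivative[OF bounded_linear_vec_nth has_derivative_ident])
  have dA: "(A has_derivative A) (at z)"
    unfolding A_def by (auto intro!: derivative_eq_intros nth)
  have dsq: "((\<lambda>z. (A z)^2 + (z$2)^2) has_derivative (\<lambda>d. 2 * A z * A d + 2 * z$2 * d$2)) (at z)"
    by (auto intro!: derivative_eq_intros nth dA simp: fun_eq_iff algebra_simps)
  have dT: "(T has_derivative T') (at z)"
    unfolding T_def T'_def t_def by (rule DERIV_compose_FDERIV[OF th dsq])
  have dW1: "(W1 has_derivative W1') (at z)"
    unfolding W1_def W1'_def W2_def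
    by (auto intro!: derivative_eq_intros nth dA dT simp: fun_eq_iff algebra_simps)
  have dW2: "(W2 has_derivative W2') (at z)"
    unfolding W2_def W2'_def W1_def
    by (auto intro!: derivative_eq_intros nth dA dT simp: fun_eq_iff algebra_simps)
  \<comment> \<open>in shear coordinates the image has coordinates \<open>W1\<close>, \<open>W2\<close>\<close>
  have eq: "plane_twist s q \<theta> = (\<lambda>z. vector [W1 z / real q - s * W2 z, W2 z])"
    by (auto simp: plane_twist_def shear_vec_def disc_twist_def shear_coord_def W1_def W2_def T_def
        A_def cmod_power2 fun_eq_iff)
  have "(plane_twist s q \<theta> has_derivative D) (at z)"
    unfolding eq by (rule has_derivative_vec2I)
      (use q in \<open>auto simp: D_def intro!: derivative_eq_intros dW1 dW2\<close>)
  moreover have "det (matrix D) = 1"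
  proof -
    define c where "c = cos (T z)"
    define n where "n = sin (T z)"
    have cn: "c^2 + n^2 = 1" by (simp add: c_def n_def)
    have W: "W1 z = A z * c - z$2 * n" "W2 z = A z * n + z$2 * c"
      by (simp_all add: W1_def W2_def c_def n_def)
    have Ax: "A (axis 1 1) = q" "A (axis 2 1) = q * s" "(axis 1 1 :: real^2)$2 = 0" "(axis 2 1 :: real^2)$2 = 1"
      by (simp_all add: A_def axis_def)
    have "det (matrix D) = (W1' (axis 1 1) * W2' (axis 2 1) - W1' (axis 2 1) * W2' (axis 1 1)) / q"
      using q by (simp add: det_2 matrix_def D_def field_simps)
    also have "\<dots> = (c^2 + n^2) + 2 * t * (W1 z * (z$2 * c + A z * n) - W2 z * (A z * c - z$2 * n))"
      using q by (simp add: W1'_def W2'_def T'_def Ax flip: c_def n_def)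
        (simp add: field_simps power2_eq_square)
    also have "\<dots> = 1" by (simp add: cn W algebra_simps)
    finally show ?thesis .
  qed
  ultimately show ?thesis by blast
qed

lemma lebesgue_preserving_plane_twist:
  assumes q: "q > 0" and th: "\<And>t. (\<theta> has_real_derivative \<theta>' t) (at t)"
  shows "lebesgue_preserving (plane_twist s q \<theta>)"
proof -
  have "\<exists>D. (plane_twist s q (\<lambda>t. - \<theta> t) has_derivative D) (at z) \<and> det (matrix D) = 1" for z
    by (rule plane_twist_derivative[OF q DERIV_minus[OF th]])
  then obtain D where D: "\<And>z. (plane_twist s q (\<lambda>t. - \<theta> t) has_derivative D z) (at z)"
    "\<And>z. det (matrix (D z)) = 1" by metis
  show ?thesis
  proof (rule lebesgue_preserving_jacobian[where g = "plane_twist s q (\<lambda>t. - \<theta> t)" and g' = D])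
    show "plane_twist s q (\<lambda>t. - \<theta> t) (plane_twist s q \<theta> z) = z" for z
      using plane_twist_inverse[OF q, of s "\<lambda>t. - \<theta> t"] by simp
    show "continuous_on UNIV (plane_twist s q \<theta>)"
      unfolding continuous_on_eq_continuous_at[OF open_UNIV]
      using plane_twist_derivative[OF q th] has_derivative_continuous by blast
  qed (auto simp: plane_twist_inverse[OF q] D)
qed

section \<open>Twisting all cells of the plane\<close>

lemma lebesgue_preserving_piecewise:
  fixes f :: "'a::euclidean_space \<Rightarrow> 'a"
  assumes f: "f \<in> borel_measurable borel"
    and C: "countable I" "disjoint_family_on C I" "\<And>i. i \<in> I \<Longrightarrow> C i \<in> sets borel" "(\<Union>i\<in>I. C i) = UNIV"
    and H: "\<And>i. i \<in> I \<Longrightarrow> lebesgue_preserving (H i)"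
    and HC: "\<And>i z. i \<in> I \<Longrightarrow> H i z \<in> C i \<longleftrightarrow> z \<in> C i"
    and fH: "\<And>i z. i \<in> I \<Longrightarrow> z \<in> C i \<Longrightarrow> f z = H i z"
  shows "lebesgue_preserving f"
  unfolding lebesgue_preserving_def
proof (intro conjI ballI f)
  fix A :: "'a set" assume A: "A \<in> sets borel"
  have fA: "f -` A \<in> sets borel" using measurable_sets[OF f A] by simp
  have "emeasure lborel (f -` A) = (\<integral>\<^sup>+i. emeasure lborel (f -` A \<inter> C i) \<partial>count_space I)"
    by (rule emeasure_countable_partition) (use C fA in auto)
  also have "\<dots> = (\<integral>\<^sup>+i. emeasure lborel (A \<inter> C i) \<partial>count_space I)"
  proof (rule nn_integral_cong)
    fix i assume "i \<in> space (count_space I)"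
    then have i: "i \<in> I" by simp
    have "f -` A \<inter> C i = H i -` (A \<inter> C i)"
      using HC[OF i] fH[OF i] by auto
    then show "emeasure lborel (f -` A \<inter> C i) = emeasure lborel (A \<inter> C i)"
      using lebesgue_preservingD[OF H[OF i], of "A \<inter> C i"] A C(3)[OF i] by simp
  qed
  also have "\<dots> = emeasure lborel A"
    by (rule emeasure_countable_partition[symmetric]) (use C A in auto)
  finally show "emeasure lborel (f -` A) = emeasure lborel A" .
qed

lemma lebesgue_preserving_compose:
  assumes "lebesgue_preserving f" "lebesgue_preserving g"
  shows "lebesgue_preserving (f \<circ> g)"
  unfolding lebesgue_preserving_def
proof (intro conjI ballI)
  have m: "f \<in> borel_measurable borel" "g \<in> borel_measurable borel"
    using assms by (auto simp: lebesgue_preserving_def)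
  then show "f \<circ> g \<in> borel_measurable borel" by (rule measurable_comp[rotated])
  fix A :: "'a set" assume A: "A \<in> sets borel"
  have "f -` A \<in> sets borel" using measurable_sets[OF m(1) A] by simp
  then show "emeasure lborel ((f \<circ> g) -` A) = emeasure lborel A"
    using lebesgue_preservingD[OF assms(1) A] lebesgue_preservingD[OF assms(2)]
    by (simp add: vimage_comp[symmetric])
qed

text \<open>In each strip between consecutive integer heights this is the linear function
  \<open>x + s (y - j)\<close>. It jumps by \<open>s\<close> at integer heights, and this jump is what survives in the
  limit as the obstruction to a semiconjugacy.\<close>
definition strip_coord :: "real \<Rightarrow> real^2 \<Rightarrow> real" where
  "strip_coord s z = z$1 + s * frac (z$2)"

text \<open>The plane is cut into cells by the integer heights and by the lines on which
  \<open>q\<close> times the strip coordinate is an integer. The cell coordinate identifies each cell with the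
  square of side \<open>1\<close> centred at the origin, where the twist is then performed.\<close>
definition cell_coord :: "real \<Rightarrow> nat \<Rightarrow> real^2 \<Rightarrow> complex" where
  "cell_coord s q z = Complex (frac (real q * strip_coord s z) - 1/2) (frac (z$2) - 1/2)"

definition cell_twist :: "real \<Rightarrow> nat \<Rightarrow> (real \<Rightarrow> real) \<Rightarrow> real^2 \<Rightarrow> real^2" where
  "cell_twist s q \<theta> z = z + shear_vec s q (disc_twist \<theta> (cell_coord s q z) - cell_coord s q z)"

lemma int_lattice2: "k \<in> (int_lattice :: (real^2) set) \<longleftrightarrow> k$1 \<in> \<int> \<and> k$2 \<in> \<int>"
  by (auto simp: int_lattice_def Basis_vec_def inner_axis forall_2)

lemma frac_add_Ints: "k \<in> \<int> \<Longrightarrow> frac (x + k) = frac x"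
  by (auto simp: frac_def elim!: Ints_cases)

lemma frac_near_Ints:
  fixes x k e :: real
  assumes "k \<in> \<int>" "\<bar>x - k\<bar> < e" "e < 1/2"
  shows "\<bar>frac x - 1/2\<bar> > 1/2 - e"
proof -
  obtain i where i: "k = of_int i" using assms(1) by (rule Ints_cases)
  show ?thesis
  proof (cases "x \<ge> k")
    case True
    then have "\<lfloor>x\<rfloor> = i" using assms i by (intro floor_unique) auto
    then show ?thesis using assms i True by (simp add: frac_def)
  next
    case False
    then have "\<lfloor>x\<rfloor> = i - 1" using assms i by (intro floor_unique) auto
    then show ?thesis using assms i False by (simp add: frac_def)
  qed
qed

lemma norm_vec2_le: "norm (z :: real^2) \<le> \<bar>z$1\<bar> + \<bar>z$2\<bar>"
  using norm_le_l1_cart[of z] by (simp add: sum_2)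

lemma shear_vec_nth [simp]:
  "shear_vec s q w $ 1 = Re w / real q - s * Im w" "shear_vec s q w $ 2 = Im w"
  by (simp_all add: shear_vec_def)

lemma cell_twist_nth:
  "cell_twist s q \<theta> z $ 1 = z$1 + (Re (disc_twist \<theta> (cell_coord s q z)) - Re (cell_coord s q z)) / real q
      - s * (Im (disc_twist \<theta> (cell_coord s q z)) - Im (cell_coord s q z))"
  "cell_twist s q \<theta> z $ 2 = z$2 + Im (disc_twist \<theta> (cell_coord s q z)) - Im (cell_coord s q z)"
  by (simp_all add: cell_twist_def)

lemma cell_coord_translate:
  assumes "real q * k$1 \<in> \<int>" "k$2 \<in> \<int>"
  shows "cell_coord s q (z + k) = cell_coord s q z"
proof -
  have "frac (real q * (z$1 + k$1 + s * frac (z$2))) = frac (real q * (z$1 + s * frac (z$2)) + real q * k$1)"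
    by (simp add: algebra_simps)
  then show ?thesis
    using assms by (simp add: cell_coord_def strip_coord_def frac_add_Ints)
qed

lemma cell_twist_translate:
  assumes "real q * k$1 \<in> \<int>" "k$2 \<in> \<int>"
  shows "cell_twist s q \<theta> (z + k) = cell_twist s q \<theta> z + k"
  by (simp add: cell_twist_def cell_coord_translate[OF assms])

lemma lattice_equivariant_cell_twist: "lattice_equivariant (cell_twist s q \<theta>)"
  unfolding lattice_equivariant_def by (auto simp: int_lattice2 intro!: cell_twist_translate)

lemma strip_coord_lattice: "k \<in> int_lattice \<Longrightarrow> strip_coord s (z + k) = strip_coord s z + k$1"
  by (simp add: int_lattice2 strip_coord_def frac_add_Ints)

text \<open>The angle vanishes outside a disc strictly inside the square, so the twists of
  different cells fit together, although the cells of adjacent strips are not aligned.\<close>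
locale twist_profile =
  fixes s :: real and q :: nat and \<theta> :: "real \<Rightarrow> real" and R :: real
  assumes q: "q > 0" and R: "0 \<le> R" "R < 1/2"
    and vanish: "\<And>t. R\<^sup>2 \<le> t \<Longrightarrow> \<theta> t = 0"
    and diff: "\<And>t. \<theta> field_differentiable (at t)"
begin

abbreviation "h \<equiv> cell_twist s q \<theta>"
abbreviation "cell \<equiv> cell_coord s q"

lemma minus: "twist_profile q (\<lambda>t. - \<theta> t) R"
  by unfold_locales (use q R vanish diff in \<open>auto intro: field_differentiable_minus\<close>)

lemma disc_twist_outside: "R \<le> cmod w \<Longrightarrow> disc_twist \<theta> w = w"
  using vanish[of "(cmod w)\<^sup>2"] R by (simp add: disc_twist_def power_mono)

lemma disc_twist_square:
  assumes "-1/2 \<le> Re w" "Re w < 1/2" "-1/2 \<le> Im w" "Im w < 1/2"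
  shows "-1/2 \<le> Re (disc_twist \<theta> w)" "Re (disc_twist \<theta> w) < 1/2"
    "-1/2 \<le> Im (disc_twist \<theta> w)" "Im (disc_twist \<theta> w) < 1/2"
proof -
  have "disc_twist \<theta> w = w \<or> (\<bar>Re (disc_twist \<theta> w)\<bar> < 1/2 \<and> \<bar>Im (disc_twist \<theta> w)\<bar> < 1/2)"
    using disc_twist_outside[of w] R abs_Re_le_cmod[of "disc_twist \<theta> w"]
      abs_Im_le_cmod[of "disc_twist \<theta> w"] by fastforce
  then show "-1/2 \<le> Re (disc_twist \<theta> w)" "Re (disc_twist \<theta> w) < 1/2"
    "-1/2 \<le> Im (disc_twist \<theta> w)" "Im (disc_twist \<theta> w) < 1/2"
    using assms by auto
qed

lemma cell_square: "-1/2 \<le> Re (cell z)" "Re (cell z) < 1/2" "-1/2 \<le> Im (cell z)" "Im (cell z) < 1/2"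
  by (simp_all add: cell_coord_def frac_lt_1)

lemmas twisted_cell_square = disc_twist_square[OF cell_square]

lemma twist_floor2: "\<lfloor>h z $ 2\<rfloor> = \<lfloor>z $ 2\<rfloor>"
  using twisted_cell_square(3,4)[of z]
  by (intro floor_unique) (auto simp: cell_twist_nth cell_coord_def frac_def)

lemma strip_coord_twist:
  "strip_coord s (h z) = strip_coord s z + (Re (disc_twist \<theta> (cell z)) - Re (cell z)) / real q"
  using twist_floor2[of z]
  by (simp add: strip_coord_def frac_def cell_twist_nth algebra_simps) 

lemma twist_floor1: "\<lfloor>real q * strip_coord s (h z)\<rfloor> = \<lfloor>real q * strip_coord s z\<rfloor>"
  using twisted_cell_square(1,2)[of z] q
  by (intro floor_unique)
     (auto simp: strip_coord_twist distrib_left, auto simp: cell_coord_def frac_def)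

lemma cell_twist_cell: "cell (h z) = disc_twist \<theta> (cell z)"
proof -
  have "frac (h z $ 2) = Im (disc_twist \<theta> (cell z)) + 1/2"
    by (simp add: frac_def twist_floor2) (simp add: cell_twist_nth cell_coord_def frac_def)
  moreover have "frac (real q * strip_coord s (h z)) = Re (disc_twist \<theta> (cell z)) + 1/2"
    using q by (simp add: frac_def twist_floor1)
      (simp add: strip_coord_twist distrib_left, simp add: cell_coord_def frac_def)
  ultimately show ?thesis by (simp add: cell_coord_def complex_eq_iff)
qed

lemma twist_inverse: "cell_twist s q (\<lambda>t. - \<theta> t) (h z) = z"
proof -
  have "cell_twist s q (\<lambda>t. - \<theta> t) (h z) = h z + shear_vec s q (cell z - disc_twist \<theta> (cell z))"
    by (simp add: cell_twist_def[of _ _ "\<lambda>t. - \<theta> t"] cell_twist_cell)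
  also have "\<dots> = z" by (simp add: cell_twist_def vec_eq_iff forall_2 diff_divide_distrib algebra_simps)
  finally show ?thesis .
qed

text \<open>Cells have width \<open>1/q\<close> in the strip coordinate and are preserved. This bound is summable
  over the construction, whereas the vertical displacement is not small.\<close>
lemma strip_coord_twist_le: "\<bar>strip_coord s (h z) - strip_coord s z\<bar> \<le> 1 / real q"
proof -
  have "\<bar>Re (disc_twist \<theta> (cell z)) - Re (cell z)\<bar> \<le> 1"
    using twisted_cell_square[of z] cell_square[of z] by linarith
  then show ?thesis using q by (simp add: strip_coord_twist abs_mult divide_right_mono)
qed

lemma twist_id:
  assumes "R \<le> \<bar>frac (z$2) - 1/2\<bar> \<or> R \<le> \<bar>frac (real q * strip_coord s z) - 1/2\<bar>"
  shows "h z = z"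
proof -
  have "R \<le> cmod (cell z)"
    using assms abs_Re_le_cmod[of "cell z"] abs_Im_le_cmod[of "cell z"] by (auto simp: cell_coord_def)
  then show ?thesis by (simp add: cell_twist_def disc_twist_outside shear_vec_def vec_eq_iff forall_2)
qed

lemma continuous_profile: "continuous_on UNIV \<theta>"
  using diff by (intro continuous_at_imp_continuous_on) (auto intro: field_differentiable_imp_continuous_at)

text \<open>Inside a cell the coordinates are continuous; near the boundary of a cell, where they
  jump, the map is the identity.\<close>
lemma isCont_twist: "isCont h z"
proof -
  consider "z$2 \<in> \<int>" | "z$2 \<notin> \<int>" "real q * strip_coord s z \<in> \<int>"
    | "z$2 \<notin> \<int>" "real q * strip_coord s z \<notin> \<int>" by blast
  then show ?thesis
  proof cases
    case 1
    have "\<forall>\<^sub>F x in nhds z. dist (x$2) (z$2) < 1/2 - R"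
      using R by (intro tendstoD) (auto intro!: tendsto_intros filterlim_ident)
    then have "\<forall>\<^sub>F x in nhds z. h x = x"
    proof eventually_elim
      case (elim x)
      then have "R < \<bar>frac (x$2) - 1/2\<bar> \<or> R = 0"
        using frac_near_Ints[OF 1, of "x$2" "1/2 - R"] R by (auto simp: dist_real_def)
      then show ?case by (intro twist_id) auto
    qed
    then show ?thesis by (subst isCont_cong[of _ "\<lambda>x. x"]) auto
  next
    case 2
    have c: "isCont (\<lambda>x. real q * strip_coord s x) z"
      unfolding strip_coord_def using 2 by (auto intro!: continuous_intros isCont_o2[OF _ continuous_frac])
    have "((\<lambda>x. real q * strip_coord s x) \<longlongrightarrow> real q * strip_coord s z) (nhds z)"
      using c unfolding isCont_def by (rule tendsto_at_iff_tendsto_nhds[THEN iffD1])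
    then have "\<forall>\<^sub>F x in nhds z. dist (real q * strip_coord s x) (real q * strip_coord s z) < 1/2 - R"
      using R by (intro tendstoD) auto
    then have "\<forall>\<^sub>F x in nhds z. h x = x"
    proof eventually_elim
      case (elim x)
      then have "R < \<bar>frac (real q * strip_coord s x) - 1/2\<bar> \<or> R = 0"
        using frac_near_Ints[OF 2(2), of "real q * strip_coord s x" "1/2 - R"] R by (auto simp: dist_real_def)
      then show ?case by (intro twist_id) auto
    qed
    then show ?thesis by (subst isCont_cong[of _ "\<lambda>x. x"]) auto
  next
    case 3
    have f2: "isCont (\<lambda>x. frac (x$2)) z"
      using 3 by (auto intro!: continuous_intros isCont_o2[OF _ continuous_frac])
    have "isCont (\<lambda>x. real q * strip_coord s x) z"
      unfolding strip_coord_def using f2 by (auto intro!: continuous_intros)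
    then have f1: "isCont (\<lambda>x. frac (real q * strip_coord s x)) z"
      by (rule isCont_o2) (rule continuous_frac[OF 3(2)])
    have c: "isCont (\<lambda>x. cell x) z"
      unfolding cell_coord_def Complex_eq using f1 f2 by (auto intro!: continuous_intros)
    have "isCont (\<lambda>x. disc_twist \<theta> (cell x)) z"
      unfolding disc_twist_def cis_conv_exp
      by (intro continuous_intros c isCont_o2[OF _ continuous_on_interior[OF continuous_profile]]) auto
    then have D: "isCont (\<lambda>x. disc_twist \<theta> (cell x) - cell x) z"
      using c by (intro continuous_intros)
    have "isCont (\<lambda>x. shear_vec s q (disc_twist \<theta> (cell x) - cell x)) z"
    proof -
      have "shear_vec s q = (\<lambda>w. (Re w / real q - s * Im w) *\<^sub>R axis 1 1 + Im w *\<^sub>R axis 2 1)"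
        by (auto simp: fun_eq_iff vec_eq_iff forall_2 axis_def)
      then show ?thesis
        using q by (auto intro!: continuous_intros D bounded_linear.isCont[OF bounded_linear_Re]
            bounded_linear.isCont[OF bounded_linear_Im] simp del: minus_complex.sel)
    qed
    then show ?thesis unfolding cell_twist_def[abs_def] by (intro continuous_intros)
  qed
qed

lemma continuous_twist: "continuous_on UNIV h"
  using isCont_twist by (intro continuous_at_imp_continuous_on) auto

text \<open>For the measure each cell is treated separately: on it the map is a translated plane twist.\<close>
definition the_cell :: "int \<times> int \<Rightarrow> (real^2) set" where
  "the_cell = (\<lambda>(i, j). {z. \<lfloor>real q * strip_coord s z\<rfloor> = i \<and> \<lfloor>z$2\<rfloor> = j})"

definition cell_centre :: "int \<times> int \<Rightarrow> real^2" where
  "cell_centre = (\<lambda>(i, j). vector [(real_of_int i + 1/2) / real q - s / 2, real_of_int j + 1/2])"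

lemma twist_eq_plane_twist:
  assumes "z \<in> the_cell c"
  shows "h z = plane_twist s q \<theta> (z - cell_centre c) + cell_centre c"
proof -
  have "shear_coord s q (z - cell_centre c) = cell z"
    using assms q by (auto simp: the_cell_def cell_centre_def shear_coord_def cell_coord_def strip_coord_def
        frac_def complex_eq_iff field_simps split: prod.splits)
  then have a: "plane_twist s q \<theta> (z - cell_centre c) = shear_vec s q (cell z) + shear_vec s q (disc_twist \<theta> (cell z) - cell z)"
    and b: "z - cell_centre c = shear_vec s q (cell z)"
    using shear_vec_coord[OF q, of s "z - cell_centre c"]
    by (auto simp: plane_twist_def vec_eq_iff forall_2 diff_divide_distrib field_simps)
  then show ?thesis 
  proof -
    have "z = (z - cell_centre c) + cell_centre c" by simp
    then have "z = shear_vec s q (cell z) + cell_centre c" by (simp only: b)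
    then have "z + X = shear_vec s q (cell z) + X + cell_centre c" for X
      by (metis add.assoc add.commute)
    then show ?thesis unfolding a by (simp only: cell_twist_def)
  qed
qed

lemma twist_mem_cell: "h z \<in> the_cell c \<longleftrightarrow> z \<in> the_cell c"
  by (auto simp: the_cell_def twist_floor1 twist_floor2 split: prod.splits)

lemma lebesgue_preserving_twist: "lebesgue_preserving h"
proof (rule lebesgue_preserving_piecewise)
  interpret m: twist_profile s q "\<lambda>t. - \<theta> t" R by (rule minus)
  let ?H = "\<lambda>c. (\<lambda>z. z + cell_centre c) \<circ> (plane_twist s q \<theta> \<circ> (\<lambda>z. z + (- cell_centre c)))"
  show "h \<in> borel_measurable borel"
    by (rule borel_measurable_continuous_onI[OF continuous_twist])
  show "countable (UNIV :: (int \<times> int) set)" by simp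
  show "disjoint_family_on the_cell UNIV"
    by (auto simp: disjoint_family_on_def the_cell_def)
  show "the_cell c \<in> sets borel" for c
  proof -
    have [measurable]: "(\<lambda>z::real^2. z $ i) \<in> borel_measurable borel" for i
      by (rule borel_measurable_continuous_onI) (auto intro!: continuous_intros)
    have [measurable]: "(frac :: real \<Rightarrow> real) \<in> borel_measurable borel"
      unfolding frac_def by measurable
    show ?thesis unfolding the_cell_def strip_coord_def by (cases c) simp
  qed
  show "(\<Union>c\<in>UNIV. the_cell c) = UNIV" by (auto simp: the_cell_def)
  obtain \<theta>' where th: "\<And>t. (\<theta> has_real_derivative \<theta>' t) (at t)"
    using diff unfolding field_differentiable_def by metis
  show "lebesgue_preserving (?H c)" for c
    by (intro lebesgue_preserving_compose lebesgue_preserving_translation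
        lebesgue_preserving_plane_twist[OF q th])
  show "h z = ?H c z" if "z \<in> the_cell c" for z c
    using twist_eq_plane_twist[OF that] by simp
  show "?H c z \<in> the_cell c \<longleftrightarrow> z \<in> the_cell c" for z c
  proof
    assume "z \<in> the_cell c"
    then show "?H c z \<in> the_cell c" using twist_eq_plane_twist[of z c] twist_mem_cell[of z c] by simp
  next
    assume z: "?H c z \<in> the_cell c"
    then have "m.h (?H c z) = z"
      using m.twist_eq_plane_twist[OF z] plane_twist_inverse[OF q, of s "\<lambda>t. - \<theta> t"] by simp
    then show "z \<in> the_cell c" using m.twist_mem_cell[of "?H c z" c] z by simp
  qed
qed

end

section \<open>A twist making a horizontal line almost dense\<close>

definition outer_radius :: "nat \<Rightarrow> real" where "outer_radius q = 1/2 - 1 / (8 * real q)"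
definition inner_radius :: "nat \<Rightarrow> real" where "inner_radius q = 1/2 - 1 / (4 * real q)"

text \<open>The angle is \<open>\<pi>/2\<close> on the inner circle and vanishes with its derivative on the outer one.
  Both radii tend to \<open>1/2\<close> as \<open>q\<close> grows, so the twisted diameter nearly spans the height of the cell.\<close>
definition profile :: "nat \<Rightarrow> real \<Rightarrow> real" where
  "profile q t = pi/2 * (max 0 ((outer_radius q)\<^sup>2 - t) / ((outer_radius q)\<^sup>2 - (inner_radius q)\<^sup>2))\<^sup>2"

lemma radii:
  assumes "q > 0"
  shows "0 < inner_radius q" "inner_radius q < outer_radius q" "outer_radius q < 1/2"
proof -
  have "1 / (4 * real q) \<le> 1/4" "0 < 1 / (8 * real q)" using assms by (auto simp: field_simps)
  moreover have "1 / (4 * real q) = 2 * (1 / (8 * real q))" by simp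
  ultimately show "0 < inner_radius q" "inner_radius q < outer_radius q" "outer_radius q < 1/2"
    unfolding inner_radius_def outer_radius_def by linarith+
qed

lemma profile_inner: "q > 0 \<Longrightarrow> profile q ((inner_radius q)\<^sup>2) = pi / 2"
proof -
  assume "q > 0"
  then have "(inner_radius q)\<^sup>2 < (outer_radius q)\<^sup>2"
    using radii[of q] by (intro power_strict_mono) auto
  then show ?thesis by (simp add: profile_def)
qed

lemma twist_profile_profile: "q > 0 \<Longrightarrow> twist_profile q (profile q) (outer_radius q)"
proof unfold_locales
  assume q: "q > 0"
  show "q > 0" "0 \<le> outer_radius q" "outer_radius q < 1/2" using q radii[OF q] by auto
  show "(outer_radius q)\<^sup>2 \<le> t \<Longrightarrow> profile q t = 0" for t by (simp add: profile_def)
  fix t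
  have "((\<lambda>t. (max 0 ((outer_radius q)\<^sup>2 - t))\<^sup>2) has_real_derivative 2 * max 0 ((outer_radius q)\<^sup>2 - t) * (-1)) (at t)"
    by (rule DERIV_chain2[OF DERIV_max_0_power2]) (auto intro!: derivative_eq_intros)
  then have "(\<lambda>t. (max 0 ((outer_radius q)\<^sup>2 - t))\<^sup>2) field_differentiable (at t)"
    unfolding field_differentiable_def by blast
  then have "(\<lambda>t. pi/2 / ((outer_radius q)\<^sup>2 - (inner_radius q)\<^sup>2)\<^sup>2 * (max 0 ((outer_radius q)\<^sup>2 - t))\<^sup>2) field_differentiable (at t)"
    by (intro field_differentiable_mult field_differentiable_const)
  then show "profile q field_differentiable (at t)"
    unfolding profile_def[abs_def] by (simp add: power_divide)
qed

text \<open>The image of the diameter of length twice the inner radius runs from near the bottom to near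
  the top of its cell, so it attains every height up to an error \<open>1/(4q)\<close>; horizontally, the cells
  repeat with period \<open>1/q\<close>.\<close>
lemma twist_curve_dense:
  assumes q: "q > 0" and s: "\<bar>s\<bar> \<le> 1"
  shows "\<exists>t. \<exists>k\<in>int_lattice. dist (cell_twist s q (profile q) (vector [t, 1/2]) + k) w \<le> 2 / real q"
proof -
  interpret twist_profile s q "profile q" "outer_radius q" by (rule twist_profile_profile[OF q])
  define r where "r = inner_radius q"
  have r: "0 < r" "r < 1/2" using radii[OF q] by (auto simp: r_def)
  define \<gamma> where "\<gamma> = (\<lambda>u. disc_twist (profile q) (Complex u 0))"
  define x y where "x = w$1" and "y = frac (w$2)"
  have y: "0 \<le> y" "y < 1" by (auto simp: y_def frac_lt_1)
  \<comment> \<open>the height nearest to \<open>y\<close> that the twisted diameter attains, relative to the centre of the cell\<close>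
  define v where "v = max (-r) (min r (y - 1/2))"
  have v: "\<bar>v - (y - 1/2)\<bar> \<le> 1 / (4 * real q)" "-r \<le> v" "v \<le> r"
  proof -
    define p where "p = 1 / (4 * real q)"
    have p: "0 < p" "p \<le> 1/4" "r = 1/2 - p"
      using q by (simp_all add: p_def r_def inner_radius_def field_simps)
    show "\<bar>v - (y - 1/2)\<bar> \<le> 1 / (4 * real q)" "-r \<le> v" "v \<le> r"
      using y p unfolding v_def p_def[symmetric] by (auto simp: max_def min_def)
  qed
  have cr: "cis (profile q (r\<^sup>2)) = \<i>" unfolding r_def profile_inner[OF q] by (simp add: complex_eq_iff)
  have ends: "Im (\<gamma> r) = r" "Im (\<gamma> (-r)) = -r"
    using cr by (simp_all add: \<gamma>_def disc_twist_def cmod_power2)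
  have "continuous_on UNIV \<gamma>"
    unfolding \<gamma>_def disc_twist_def cis_conv_exp Complex_eq
    by (intro continuous_intros continuous_on_compose2[OF continuous_profile]) auto
  then have "continuous_on {-r..r} (\<lambda>u. Im (\<gamma> u))"
    by (intro continuous_intros) (rule continuous_on_subset, auto)
  then obtain u where u: "-r \<le> u" "u \<le> r" "Im (\<gamma> u) = v"
    using IVT'[of "\<lambda>u. Im (\<gamma> u)" "-r" v r] ends v r by auto
  \<comment> \<open>the index of the cell in which the curve comes close to the target\<close>
  define m where "m = \<lfloor>real q * (x + s * y) - Re (\<gamma> u) - 1/2\<rfloor>"
  define t where "t = (of_int m + 1/2 + u) / real q - s / 2"
  have sc: "real q * strip_coord s (vector [t, 1/2]) = of_int m + (1/2 + u)"
    using q by (simp add: strip_coord_def t_def frac_def)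
  have cell: "cell (vector [t, 1/2]) = Complex u 0"
  proof -
    have "frac (real_of_int m + (1/2 + u)) = frac (1/2 + u)"
      using frac_add_Ints[of "real_of_int m" "1/2 + u"] by (simp add: add.commute)
    also have "\<dots> = 1/2 + u" using u r by (intro frac_eq[THEN iffD2]) auto
    finally show ?thesis unfolding cell_coord_def sc by (simp add: complex_eq_iff frac_def)
  qed
  have h1: "h (vector [t, 1/2]) $ 1 = (of_int m + 1/2 + Re (\<gamma> u)) / real q - s / 2 - s * v"
    using q u(3) by (simp add: cell_twist_nth cell flip: \<gamma>_def) (simp add: t_def \<gamma>_def add_divide_distrib diff_divide_distrib)
  have h2: "h (vector [t, 1/2]) $ 2 = 1/2 + v"
    using u(3) by (simp add: cell_twist_nth cell flip: \<gamma>_def) (simp add: \<gamma>_def)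
  define k :: "real^2" where "k = vector [0, of_int \<lfloor>w$2\<rfloor>]"
  have k: "k \<in> int_lattice" by (simp add: k_def int_lattice2)
  define d where "d = h (vector [t, 1/2]) + k - w"
  have "d$1 = (of_int m + 1/2 + Re (\<gamma> u) - real q * (x + s * y)) / real q + s * (y - 1/2 - v)"
    using q by (simp add: d_def h1 k_def x_def) (simp add: field_simps)
  moreover have "\<bar>(of_int m + 1/2 + Re (\<gamma> u) - real q * (x + s * y)) / real q\<bar> \<le> 1 / real q"
  proof -
    have "\<bar>of_int m + 1/2 + Re (\<gamma> u) - real q * (x + s * y)\<bar> \<le> 1"
      unfolding m_def by linarith
    then show ?thesis using q by (simp add: abs_divide divide_right_mono)
  qed
  moreover have "\<bar>s * (y - 1/2 - v)\<bar> \<le> 1 * (1 / (4 * real q))"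
    unfolding abs_mult using v s by (intro mult_mono) auto
  moreover have "c = a + b \<Longrightarrow> \<bar>a\<bar> \<le> A \<Longrightarrow> \<bar>b\<bar> \<le> 1 * B \<Longrightarrow> \<bar>c\<bar> \<le> A + B" for a b c A B :: real
    by linarith
  ultimately have d1: "\<bar>d$1\<bar> \<le> 1 / real q + 1 / (4 * real q)" by blast
  have "d$2 = v - (y - 1/2)" by (simp add: d_def h2 k_def y_def frac_def)
  then have "\<bar>d$2\<bar> \<le> 1 / (4 * real q)" using v by simp
  then have "norm d \<le> 1 / real q + 1 / (4 * real q) + 1 / (4 * real q)"
    using d1 norm_vec2_le[of d] by linarith
  also have "\<dots> \<le> 2 / real q" using q by (simp add: field_simps)
  finally have "dist (h (vector [t, 1/2]) + k) w \<le> 2 / real q" by (simp add: d_def dist_norm)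
  then show ?thesis using k by blast
qed

section \<open>Conjugates of horizontal translations\<close>

lemma homeomorphism_UNIV_inv:
  assumes "homeomorphism UNIV UNIV K Ki"
  shows "inv K = Ki" "K (Ki z) = z" "Ki (K z) = z"
proof -
  show *: "K (Ki z) = z" "Ki (K z) = z" for z using assms by (auto simp: homeomorphism_def)
  show "inv K = Ki" by (rule inv_unique_comp) (auto simp: fun_eq_iff *)
qed

lemma lebesgue_preserving_inverse:
  assumes FG: "homeomorphism UNIV UNIV F G" and "lebesgue_preserving F"
  shows "lebesgue_preserving G"
  unfolding lebesgue_preserving_def
proof (intro conjI ballI)
  show m: "G \<in> borel_measurable borel"
    using FG by (intro borel_measurable_continuous_onI) (auto simp: homeomorphism_def)
  fix A :: "'a set" assume A: "A \<in> sets borel"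
  have "emeasure lborel (F -` (G -` A)) = emeasure lborel (G -` A)"
    using measurable_sets[OF m A] by (intro lebesgue_preservingD[OF assms(2)]) simp
  then show "emeasure lborel (G -` A) = emeasure lborel A"
    by (simp add: vimage_def homeomorphism_UNIV_inv[OF FG])
qed

text \<open>The conjugating homeomorphisms. Being the identity near the integer heights, with a margin
  that may depend on the map, makes every conjugate of a translation equal to that translation
  there.\<close>
definition admissible :: "(real^2 \<Rightarrow> real^2) \<Rightarrow> bool" where
  "admissible K \<longleftrightarrow> (\<exists>Ki. homeomorphism UNIV UNIV K Ki) \<and> lattice_equivariant K \<and>
     lebesgue_preserving K \<and> (\<forall>z. \<lfloor>K z $ 2\<rfloor> = \<lfloor>z $ 2\<rfloor>) \<and>
     (\<exists>\<delta>>0. \<forall>z. 1/2 - \<delta> \<le> \<bar>frac (z$2) - 1/2\<bar> \<longrightarrow> K z = z)"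

lemma admissible_inv:
  assumes "admissible K"
  shows "admissible (inv K)" "homeomorphism UNIV UNIV K (inv K)"
    "K (inv K z) = z" "inv K (K z) = z"
proof -
  obtain Ki \<delta> where hom: "homeomorphism UNIV UNIV K Ki" and
    K: "lattice_equivariant K" "lebesgue_preserving K" "\<And>z. \<lfloor>K z $ 2\<rfloor> = \<lfloor>z $ 2\<rfloor>"
    "\<delta> > 0" "\<And>z. 1/2 - \<delta> \<le> \<bar>frac (z$2) - 1/2\<bar> \<Longrightarrow> K z = z"
    using assms unfolding admissible_def by metis
  note inv = homeomorphism_UNIV_inv[OF hom]
  show "homeomorphism UNIV UNIV K (inv K)" using hom inv by simp
  show "K (inv K z) = z" "inv K (K z) = z" using inv by simp_all
  show "admissible (inv K)"
    unfolding admissible_def inv(1)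
  proof (intro conjI exI[of _ K] exI[of _ \<delta>] allI impI)
    show "homeomorphism UNIV UNIV Ki K" using hom by (rule homeomorphism_symD)
    show "lattice_equivariant Ki" by (rule lattice_equivariant_inverse[OF K(1)]) (simp_all add: inv)
    show "lebesgue_preserving Ki" by (rule lebesgue_preserving_inverse[OF hom K(2)])
    show "\<lfloor>Ki z $ 2\<rfloor> = \<lfloor>z $ 2\<rfloor>" for z using K(3)[of "Ki z"] inv by simp
    show "\<delta> > 0" by (rule K(4))
    show "Ki z = z" if "1/2 - \<delta> \<le> \<bar>frac (z$2) - 1/2\<bar>" for z
      using K(5)[OF that] inv(3)[of z] by simp
  qed
qed

lemma admissibleD:
  assumes "admissible K"
  shows "continuous_on UNIV K" "lattice_equivariant K" "lebesgue_preserving K" "\<lfloor>K z $ 2\<rfloor> = \<lfloor>z $ 2\<rfloor>"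
    "z$2 \<in> \<int> \<Longrightarrow> K z = z"
    using assms by (auto simp: admissible_def homeomorphism_def frac_eq_0_iff[THEN iffD2])

lemma admissible_compose:
  assumes K: "admissible K" and H: "admissible H"
  shows "admissible (K \<circ> H)" "inv (K \<circ> H) z = inv H (inv K z)"
proof -
  have hom: "homeomorphism UNIV UNIV (K \<circ> H) (inv H \<circ> inv K)"
    by (rule homeomorphism_compose[OF admissible_inv(2)[OF H] admissible_inv(2)[OF K]])
  show "inv (K \<circ> H) z = inv H (inv K z)" using homeomorphism_UNIV_inv(1)[OF hom] by simp
  obtain d e where d: "d > 0" "\<And>z. 1/2 - d \<le> \<bar>frac (z$2) - 1/2\<bar> \<Longrightarrow> K z = z"
    and e: "e > 0" "\<And>z. 1/2 - e \<le> \<bar>frac (z$2) - 1/2\<bar> \<Longrightarrow> H z = z"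
    using assms unfolding admissible_def by metis
  show "admissible (K \<circ> H)"
    unfolding admissible_def
  proof (intro conjI exI[of _ "inv H \<circ> inv K"] exI[of _ "min d e"] allI impI hom)
    show "lattice_equivariant (K \<circ> H)"
      using admissibleD(2)[OF K] admissibleD(2)[OF H] by (auto simp: lattice_equivariant_def)
    show "lebesgue_preserving (K \<circ> H)"
      by (intro lebesgue_preserving_compose admissibleD K H)
    show "\<lfloor>(K \<circ> H) z $ 2\<rfloor> = \<lfloor>z $ 2\<rfloor>" for z
      by (simp add: admissibleD(4)[OF K] admissibleD(4)[OF H])
    show "min d e > 0" using d e by simp
    show "(K \<circ> H) z = z" if "1/2 - min d e \<le> \<bar>frac (z$2) - 1/2\<bar>" for z
      using d(2)[of z] e(2)[of z] that by (simp add: min_def split: if_splits)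
  qed
qed

lemma admissible_twist:
  assumes q: "q > 0"
  shows "admissible (cell_twist s q (profile q))"
proof -
  interpret twist_profile s q "profile q" "outer_radius q" by (rule twist_profile_profile[OF q])
  interpret m: twist_profile s q "\<lambda>t. - profile q t" "outer_radius q" by (rule minus)
  show ?thesis
    unfolding admissible_def
  proof (intro conjI exI[of _ m.h] exI[of _ "1/2 - outer_radius q"] allI impI)
    show "homeomorphism UNIV UNIV h m.h"
      using continuous_twist m.continuous_twist twist_inverse m.twist_inverse
      by (intro homeomorphismI) auto
    show "0 < 1/2 - outer_radius q" using R by simp
    show "h z = z" if "1/2 - (1/2 - outer_radius q) \<le> \<bar>frac (z$2) - 1/2\<bar>" for z
      using that by (intro twist_id) simp
    show "lattice_equivariant h" by (rule lattice_equivariant_cell_twist)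
    show "lebesgue_preserving h" by (rule lebesgue_preserving_twist)
    show "\<lfloor>h z $ 2\<rfloor> = \<lfloor>z $ 2\<rfloor>" for z by (rule twist_floor2)
  qed
qed

definition rot_conj :: "(real^2 \<Rightarrow> real^2) \<Rightarrow> real \<Rightarrow> real^2 \<Rightarrow> real^2" where
  "rot_conj K a z = K (inv K z + vector [a, 0])"

lemma vector_add_1: "vector [a, 0] + vector [b, 0] = (vector [a + b, 0] :: real^2)"
  by (simp add: vec_eq_iff forall_2)

lemma vector_0: "vector [0, 0] = (0 :: real^2)"
  by (simp add: vec_eq_iff forall_2)

lemma rot_conj_0: "admissible K \<Longrightarrow> rot_conj K 0 z = z"
  by (simp add: rot_conj_def vector_0 admissible_inv)

lemma rot_conj_add: "admissible K \<Longrightarrow> rot_conj K a (rot_conj K b z) = rot_conj K (a + b) z"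
  by (simp add: rot_conj_def admissible_inv vector_add_1 add.assoc) (simp only: add.commute)

lemma rot_conj_funpow: "admissible K \<Longrightarrow> (rot_conj K a ^^ n) z = rot_conj K (real n * a) z"
  by (induction n) (simp_all add: rot_conj_0 rot_conj_add algebra_simps)

lemma continuous_rot_conj: "admissible K \<Longrightarrow> continuous_on UNIV (rot_conj K a)"
  unfolding rot_conj_def[abs_def]
  by (rule continuous_on_compose2[OF admissibleD(1)[of K]])
     (auto intro!: continuous_on_add continuous_on_const admissibleD(1)[OF admissible_inv(1)])

lemma rot_conj_properties:
  assumes K: "admissible K"
  shows "lattice_equivariant (rot_conj K a)" "lebesgue_preserving (rot_conj K a)"
    "\<lfloor>rot_conj K a z $ 2\<rfloor> = \<lfloor>z $ 2\<rfloor>"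
    "z$2 \<in> \<int> \<Longrightarrow> rot_conj K a z = z + vector [a, 0]"
proof -
  note Ki = admissible_inv(1)[OF K]
  show "lattice_equivariant (rot_conj K a)"
    unfolding lattice_equivariant_def rot_conj_def
  proof (intro allI ballI)
    fix z k :: "real^2" assume k: "k \<in> int_lattice"
    have "inv K (z + k) + vector [a, 0] = inv K z + vector [a, 0] + k"
      by (simp add: lattice_equivariantD[OF admissibleD(2)[OF Ki] k])
    then show "K (inv K (z + k) + vector [a, 0]) = K (inv K z + vector [a, 0]) + k"
      by (simp only: lattice_equivariantD[OF admissibleD(2)[OF K] k])
  qed
  have "rot_conj K a = K \<circ> ((\<lambda>z. z + vector [a, 0]) \<circ> inv K)"
    by (auto simp: rot_conj_def)
  then show "lebesgue_preserving (rot_conj K a)"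
    by (auto intro: lebesgue_preserving_compose lebesgue_preserving_translation admissibleD K Ki)
  show "\<lfloor>rot_conj K a z $ 2\<rfloor> = \<lfloor>z $ 2\<rfloor>"
    by (simp add: rot_conj_def admissibleD(4)[OF K] admissibleD(4)[OF Ki])
  show "rot_conj K a z = z + vector [a, 0]" if "z$2 \<in> \<int>"
    using that by (simp add: rot_conj_def admissibleD(5)[OF Ki] admissibleD(5)[OF K])
qed

text \<open>The new twist commutes with the old translation. Hence the next conjugate is close to the
  present one as soon as the two translation lengths are close, whatever the twist does.\<close>
lemma rot_conj_compose_twist:
  assumes K: "admissible K" and q: "q > 0" "real q * a \<in> \<int>"
  shows "rot_conj (K \<circ> cell_twist s q (profile q)) a = rot_conj K a"
proof
  fix z
  note H = admissible_twist[OF q(1), of s]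
  show "rot_conj (K \<circ> cell_twist s q (profile q)) a z = rot_conj K a z"
    using q by (simp add: rot_conj_def admissible_compose(2)[OF K H] cell_twist_translate admissible_inv(3)[OF H])
qed

text \<open>Translate one of the two points into the unit cell, and use compactness of a larger box.\<close>
lemma lattice_equivariant_uniformly_continuous:
  fixes F :: "'a::euclidean_space \<Rightarrow> 'a"
  assumes eq: "lattice_equivariant F" and F: "continuous_on UNIV F" and e: "e > 0"
  shows "\<exists>d>0. \<forall>x y. dist x y < d \<longrightarrow> dist (F x) (F y) < e"
proof -
  \<comment> \<open>contains the unit cell together with all points at distance less than \<open>1\<close> from it\<close>
  define S :: "'a set" where "S = cbox (- One) (2 *\<^sub>R One)"
  have "uniformly_continuous_on S F"
    by (intro compact_uniformly_continuous continuous_on_subset[OF F]) (auto simp: S_def)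
  then obtain d where d: "d > 0" "\<And>x y. x \<in> S \<Longrightarrow> y \<in> S \<Longrightarrow> dist x y < d \<Longrightarrow> dist (F x) (F y) < e"
    using e unfolding uniformly_continuous_on_def by metis
  show ?thesis
  proof (intro exI[of _ "min d 1"] conjI allI impI)
    show "min d 1 > 0" using d by simp
    fix x y :: 'a assume xy: "dist x y < min d 1"
    obtain k where k: "k \<in> int_lattice" "x - k \<in> unit_cell"
      using unit_cell_translates(2) by fast
    have x: "0 \<le> (x - k) \<bullet> b \<and> (x - k) \<bullet> b < 1" if "b \<in> Basis" for b
      using k that by (auto simp: unit_cell_def)
    have y: "-1 \<le> (y - k) \<bullet> b \<and> (y - k) \<bullet> b \<le> 2" if "b \<in> Basis" for b
    proof -
      have "\<bar>(y - x) \<bullet> b\<bar> < 1"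
        using Basis_le_norm[OF that, of "y - x"] xy by (simp add: dist_norm norm_minus_commute)
      then show ?thesis using x[OF that] unfolding inner_diff_left by linarith
    qed
    have "-1 \<le> (x - k) \<bullet> b \<and> (x - k) \<bullet> b \<le> 2" if "b \<in> Basis" for b
      using x[OF that] by linarith
    then have "x - k \<in> S" "y - k \<in> S"
      using y by (simp_all add: S_def mem_box)
    then have "dist (F (x - k)) (F (y - k)) < e" using xy by (intro d) (auto simp: dist_norm)
    moreover have "F (z - k) = F z - k" for z
      using lattice_equivariantD[OF eq int_lattice_minus[OF k(1)], of z] by simp
    ultimately show "dist (F x) (F y) < e" by (simp add: dist_norm)
  qed
qed

text \<open>Visits to any two \<open>e\<close>-balls by the same orbit, in the prescribed order. The order
  is needed because transitivity concerns forward orbits; the existence of one starting point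
  that is good for all pairs is what finite orbit segments of periodic approximations provide.\<close>
definition eps_transitive :: "(real^2 \<Rightarrow> real^2) \<Rightarrow> real \<Rightarrow> bool" where
  "eps_transitive F e \<longleftrightarrow> (\<exists>z. \<forall>w\<^sub>1 w\<^sub>2. \<exists>i j. \<exists>k\<in>int_lattice. \<exists>l\<in>int_lattice. i \<le> j \<and>
     dist ((F ^^ i) z + k) w\<^sub>1 < e \<and> dist ((F ^^ j) z + l) w\<^sub>2 < e)"

lemma funpow_close:
  fixes F :: "'a::metric_space \<Rightarrow> 'a"
  assumes F: "\<And>e. e > 0 \<Longrightarrow> \<exists>d>0. \<forall>x y. dist x y < d \<longrightarrow> dist (F x) (F y) < e"
  shows "e > 0 \<Longrightarrow> \<exists>\<eta>>0. \<forall>G. (\<forall>z. dist (G z) (F z) \<le> \<eta>) \<longrightarrow> (\<forall>n\<le>N. \<forall>z. dist ((G ^^ n) z) ((F ^^ n) z) < e)"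
proof (induction N arbitrary: e)
  case 0
  then show ?case by (intro exI[of _ 1]) auto
next
  case (Suc N)
  obtain d where d: "d > 0" "\<And>x y. dist x y < d \<Longrightarrow> dist (F x) (F y) < e / 2"
    using F[of "e / 2"] Suc.prems by auto
  obtain \<eta> where \<eta>: "\<eta> > 0"
    "\<And>G n z. \<forall>z. dist (G z) (F z) \<le> \<eta> \<Longrightarrow> n \<le> N \<Longrightarrow> dist ((G ^^ n) z) ((F ^^ n) z) < min e d"
    using Suc.IH[of "min e d"] Suc.prems d by auto
  show ?case
  proof (intro exI[of _ "min \<eta> (e / 4)"] conjI allI impI)
    show "0 < min \<eta> (e / 4)" using \<eta> Suc.prems by simp
    fix G n z assume G: "\<forall>z. dist (G z) (F z) \<le> min \<eta> (e / 4)" and n: "n \<le> Suc N"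
    have G1: "\<forall>z. dist (G z) (F z) \<le> \<eta>" using G by simp
    show "dist ((G ^^ n) z) ((F ^^ n) z) < e"
    proof (cases "n \<le> N")
      case True
      then show ?thesis using \<eta>(2)[OF G1 True, of z] by simp
    next
      case False
      then have n: "n = Suc N" using n by simp
      have "dist (F ((G ^^ N) z)) (F ((F ^^ N) z)) < e / 2"
        using \<eta>(2)[OF G1, of N z] by (intro d) simp
      moreover have "dist (G ((G ^^ N) z)) (F ((G ^^ N) z)) \<le> e / 4" using G by simp
      ultimately have "dist (G ((G ^^ N) z)) (F ((F ^^ N) z)) < e"
        using dist_triangle[of "G ((G ^^ N) z)" "F ((F ^^ N) z)" "F ((G ^^ N) z)"] Suc.prems by linarith
      then show ?thesis by (simp add: n)
    qed
  qed
qed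

section \<open>Successive approximation\<close>

text \<open>The point \<open>(0, 1/2)\<close> of the line has orbit under the translation containing, modulo the
  lattice, all \<open>(m/L, 1/2)\<close>: every \<open>q\<close>-th step advances by \<open>1/L\<close>. The twist makes the line
  almost dense, and \<open>K\<close> distorts the remaining error to at most \<open>e\<close>. Going around twice
  provides the second visit after the first. Only \<open>2 q L\<close> iterates occur, so the
  property persists under small perturbations.\<close>
lemma rot_conj_eps_transitive:
  fixes K :: "real^2 \<Rightarrow> real^2" and q L :: nat and s a e :: real
  defines "K' \<equiv> K \<circ> cell_twist s q (profile q)" and "a' \<equiv> a + 1 / real (q * L)"
  assumes K: "admissible K" and q: "q > 0" "real q * a \<in> \<int>" and s: "\<bar>s\<bar> \<le> 1" and L: "L > 0" and e: "e > 0"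
    and modK: "\<And>x y. dist x y \<le> 2 / real q \<Longrightarrow> dist (K x) (K y) < e"
    and modK': "\<And>x y. dist x y \<le> 1 / real L \<Longrightarrow> dist (K' x) (K' y) < e"
  shows "\<exists>\<eta>>0. \<forall>G. (\<forall>z. dist (G z) (rot_conj K' a' z) \<le> \<eta>) \<longrightarrow> eps_transitive G (3 * e)"
proof -
  note H = admissible_twist[OF q(1), of s]
  have K': "admissible K'" unfolding K'_def by (rule admissible_compose(1)[OF K H])
  define z where "z = K' (vector [0, 1/2])"
  have orbit: "(rot_conj K' a' ^^ n) z = K' (vector [real n * a', 1/2])" for n
  proof -
    have "vector [0, 1/2] + vector [real n * a', 0] = (vector [real n * a', 1/2] :: real^2)"
      by (simp add: vec_eq_iff forall_2)
    then show ?thesis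
      by (simp add: rot_conj_funpow[OF K'] z_def rot_conj_def admissible_inv[OF K'])
  qed
  have hit: "\<exists>k\<in>int_lattice. \<exists>i<L. dist ((rot_conj K' a' ^^ (q * (i + n * L))) z + k) w < 2 * e" for w n
  proof -
    obtain t k where k: "k \<in> int_lattice"
      and tk: "dist (cell_twist s q (profile q) (vector [t, 1/2]) + k) (inv K w) \<le> 2 / real q"
      using twist_curve_dense[OF q(1) s] by blast
    have "dist (K (cell_twist s q (profile q) (vector [t, 1/2]) + k)) (K (inv K w)) < e"
      by (rule modK[OF tk])
    then have 1: "dist (K' (vector [t, 1/2]) + k) w < e"
      using k by (simp add: K'_def admissible_inv(3)[OF K] lattice_equivariantD[OF admissibleD(2)[OF K]])
    define m where "m = \<lfloor>t * real L\<rfloor>"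
    define i where "i = nat (m mod int L)"
    have i: "i < L" "int i = m mod int L" using L by (auto simp: i_def nat_less_iff)
    have "real_of_int m = real_of_int (int L * (m div int L) + m mod int L)" by simp
    also have "\<dots> = real L * real_of_int (m div int L) + real i"
      using i(2) by (metis of_int_add of_int_mult of_int_of_nat_eq)
    finally have mi: "real_of_int m = real L * real_of_int (m div int L) + real i" .
    obtain p where p: "real q * a = of_int p" using q(2) by (rule Ints_cases)
    \<comment> \<open>the number of full turns made by the orbit when it arrives at \<open>m / L\<close>\<close>
    define l where "l = (int i + int n * int L) * p + int n - m div int L"
    have "real (q * (i + n * L)) * a' = (real i + real n * real L) * (real q * a) + (real i + real n * real L) / real L"
      using q L by (simp add: a'_def field_simps)
    also have "\<dots> = real_of_int m / real L + real_of_int l"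
      unfolding p using L by (simp add: mi l_def field_simps)
    finally have angle: "real (q * (i + n * L)) * a' = real_of_int m / real L + real_of_int l" .
    define l' :: "real^2" where "l' = vector [- real_of_int l, 0]"
    have l': "l' \<in> int_lattice" by (simp add: l'_def int_lattice2)
    have "vector [real (q * (i + n * L)) * a', 1/2] + l' = (vector [real_of_int m / real L, 1/2] :: real^2)"
      unfolding angle by (simp add: l'_def vec_eq_iff forall_2)
    then have 2: "(rot_conj K' a' ^^ (q * (i + n * L))) z + l' = K' (vector [real_of_int m / real L, 1/2])"
      unfolding orbit by (simp flip: lattice_equivariantD[OF admissibleD(2)[OF K'] l'])
    have "dist (vector [real_of_int m / real L, 1/2]) (vector [t, 1/2] :: real^2) \<le> 1 / real L"
    proof -
      have "norm (vector [real_of_int m / real L, 1/2] - vector [t, 1/2] :: real^2) \<le> \<bar>real_of_int m / real L - t\<bar>"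
        using norm_vec2_le[of "vector [real_of_int m / real L, 1/2] - vector [t, 1/2] :: real^2"] by simp
      also have "real_of_int m / real L - t = (real_of_int m - t * real L) / real L"
        using L by (simp add: field_simps)
      also have "\<bar>\<dots>\<bar> \<le> 1 / real L"
      proof -
        have "\<bar>real_of_int m - t * real L\<bar> \<le> 1" unfolding m_def by linarith
        then show ?thesis using L by (simp add: abs_divide divide_right_mono)
      qed
      finally show ?thesis by (simp add: dist_norm)
    qed
    then have 3: "dist (K' (vector [real_of_int m / real L, 1/2])) (K' (vector [t, 1/2])) < e"
      by (rule modK')
    have "dist ((rot_conj K' a' ^^ (q * (i + n * L))) z + (l' + k)) w
        \<le> dist (K' (vector [real_of_int m / real L, 1/2]) + k) (K' (vector [t, 1/2]) + k)
          + dist (K' (vector [t, 1/2]) + k) w"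
      unfolding add.assoc[symmetric] 2 by (rule dist_triangle)
    then have "dist ((rot_conj K' a' ^^ (q * (i + n * L))) z + (l' + k)) w < 2 * e"
      using 1 3 by simp
    then show ?thesis using i(1) int_lattice_add[OF l' k] by blast
  qed
  have unif: "\<exists>d>0. \<forall>x y. dist x y < d \<longrightarrow> dist (rot_conj K' a' x) (rot_conj K' a' y) < e" if "e > 0" for e
    by (rule lattice_equivariant_uniformly_continuous[OF rot_conj_properties(1)[OF K'] continuous_rot_conj[OF K'] that])
  obtain \<eta> where \<eta>: "\<eta> > 0" "\<And>G n x. \<forall>x. dist (G x) (rot_conj K' a' x) \<le> \<eta> \<Longrightarrow> n \<le> 2 * q * L \<Longrightarrow>
      dist ((G ^^ n) x) ((rot_conj K' a' ^^ n) x) < e"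
    using funpow_close[of "rot_conj K' a'" e "2 * q * L", OF unif e] by blast
  show ?thesis
  proof (intro exI[of _ \<eta>] conjI allI impI \<eta>(1))
    fix G assume G: "\<forall>x. dist (G x) (rot_conj K' a' x) \<le> \<eta>"
    have hitG: "\<exists>k\<in>int_lattice. \<exists>i<L. dist ((G ^^ (q * (i + n * L))) z + k) w < 3 * e" if "n \<le> 1" for w n
    proof -
      obtain k i where k: "k \<in> int_lattice" "i < L"
        and d: "dist ((rot_conj K' a' ^^ (q * (i + n * L))) z + k) w < 2 * e" using hit by blast
      have "n * L \<le> L" using that by (cases n) auto
      then have "i + n * L \<le> 2 * L" using k by linarith
      then have "q * (i + n * L) \<le> q * (2 * L)" by (rule mult_le_mono2)
      then have "q * (i + n * L) \<le> 2 * q * L" by simp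
      from \<eta>(2)[OF G this, of z]
      have "dist ((G ^^ (q * (i + n * L))) z + k) ((rot_conj K' a' ^^ (q * (i + n * L))) z + k) < e" by simp
      then have "dist ((G ^^ (q * (i + n * L))) z + k) w < 3 * e"
        using d dist_triangle[of "(G ^^ (q * (i + n * L))) z + k" w "(rot_conj K' a' ^^ (q * (i + n * L))) z + k"]
        by linarith
      then show ?thesis using k by blast
    qed
    show "eps_transitive G (3 * e)"
      unfolding eps_transitive_def
    proof (intro exI[of _ z] allI)
      fix w\<^sub>1 w\<^sub>2
      obtain k i where k: "k \<in> int_lattice" "i < L" "dist ((G ^^ (q * (i + 0 * L))) z + k) w\<^sub>1 < 3 * e"
        using hitG[of 0 w\<^sub>1] by blast
      obtain l j where l: "l \<in> int_lattice" "j < L" "dist ((G ^^ (q * (j + 1 * L))) z + l) w\<^sub>2 < 3 * e"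
        using hitG[of 1 w\<^sub>2] by blast
      have "q * (i + 0 * L) \<le> q * (j + 1 * L)" using k l by (intro mult_le_mono2) simp
      then show "\<exists>i j. \<exists>k\<in>int_lattice. \<exists>l\<in>int_lattice. i \<le> j \<and>
          dist ((G ^^ i) z + k) w\<^sub>1 < 3 * e \<and> dist ((G ^^ j) z + l) w\<^sub>2 < 3 * e"
        using k l by blast
    qed
  qed
qed

text \<open>A stage consists of the conjugacy \<open>K\<close>, the rational translation length \<open>a\<close>, a
  denominator \<open>q\<close> of it, and the tolerance \<open>\<eta>\<close> within which all later maps must stay. The
  denominator is so large that \<open>K\<close> distorts the error of the next twist only slightly.\<close>
definition stage :: "nat \<Rightarrow> (real^2 \<Rightarrow> real^2) \<times> real \<times> nat \<times> real \<Rightarrow> bool" where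
  "stage n = (\<lambda>(K, a, q, \<eta>). admissible K \<and> q > 0 \<and> real q * a \<in> \<int> \<and> \<eta> > 0 \<and>
     (\<forall>x y. dist x y \<le> 2 / real q \<longrightarrow> dist (K x) (K y) < 1 / real (n + 1)))"

definition next_stage :: "real \<Rightarrow> nat \<Rightarrow> (real^2 \<Rightarrow> real^2) \<times> real \<times> nat \<times> real \<Rightarrow>
    (real^2 \<Rightarrow> real^2) \<times> real \<times> nat \<times> real \<Rightarrow> bool" where
  "next_stage s n = (\<lambda>(K, a, q, \<eta>) (K', a', q', \<eta>').
     K' = K \<circ> cell_twist s q (profile q) \<and> a' = a + 1 / real q' \<and> 2 * q \<le> q' \<and> \<eta>' \<le> \<eta> / 2 \<and>
     (\<forall>z. dist (rot_conj K' a' z) (rot_conj K a z) \<le> \<eta> / 2) \<and>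
     (\<forall>z. dist (rot_conj K' (- a') z) (rot_conj K (- a) z) \<le> \<eta> / 2) \<and>
     (\<forall>G. (\<forall>z. dist (G z) (rot_conj K' a' z) \<le> \<eta>') \<longrightarrow> eps_transitive G (3 / real (n + 1))))"

text \<open>All requirements hold once the factor \<open>L\<close> by which the denominator grows is large: they
  only involve the modulus of continuity of the next conjugacy, which is fixed before \<open>L\<close>.\<close>
lemma next_stage_exists:
  assumes s: "\<bar>s\<bar> \<le> 1" and st: "stage n S"
  shows "\<exists>S'. stage (Suc n) S' \<and> next_stage s n S S'"
proof -
  obtain K a q \<eta> where S: "S = (K, a, q, \<eta>)" by (metis prod_cases4)
  have K: "admissible K" and q: "q > 0" "real q * a \<in> \<int>" and \<eta>: "\<eta> > 0"
    and modK: "\<And>x y. dist x y \<le> 2 / real q \<Longrightarrow> dist (K x) (K y) < 1 / real (n + 1)"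
    using st by (auto simp: S stage_def)
  define K' where "K' = K \<circ> cell_twist s q (profile q)"
  have K': "admissible K'" unfolding K'_def by (intro admissible_compose admissible_twist K q)
  define e where "e = min (1 / real (n + 2)) (\<eta> / 2)"
  have e: "e > 0" "e \<le> 1 / real (n + 2)" "e \<le> \<eta> / 2" using \<eta> by (auto simp: e_def)
  obtain d where d: "d > 0" "\<And>x y. dist x y < d \<Longrightarrow> dist (K' x) (K' y) < e"
    using lattice_equivariant_uniformly_continuous[OF admissibleD(2,1)[OF K'] e(1)] by blast
  obtain L0 :: nat where L0: "2 / d < real L0" using reals_Archimedean2 by blast
  define L where "L = L0 + 2"
  have L: "L \<ge> 2" "2 / real L < d" using L0 d(1) by (auto simp: L_def field_simps) 
  define q' where "q' = q * L"
  have qq: "2 * q \<le> q'" "q' > 0" "real L \<le> real q'" using L q by (auto simp: q'_def)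
  have "2 / real q' \<le> 2 / real L" using qq(3) L by (intro divide_left_mono) auto
  then have small: "2 / real q' < d" using L by linarith
  define a' where "a' = a + 1 / real q'"
  have nn: "1 / real (n + 2) \<le> 1 / real (n + 1)" by (simp add: field_simps)
  have modK': "dist (K' x) (K' y) < 1 / real (n + 1)" if "dist x y \<le> 1 / real L" for x y
  proof -
    have "dist x y < d" using that L by (smt (verit) divide_right_mono of_nat_0_le_iff)
    then show ?thesis using d(2)[of x y] e nn by linarith
  qed
  have "\<exists>\<eta>>0. \<forall>G. (\<forall>z. dist (G z) (rot_conj K' a' z) \<le> \<eta>) \<longrightarrow> eps_transitive G (3 * (1 / real (n + 1)))"
    unfolding K'_def a'_def q'_def
    by (rule rot_conj_eps_transitive[OF K q s _ _ modK modK'[unfolded K'_def]]) (use L in auto)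
  then obtain \<eta>1 where \<eta>1: "\<eta>1 > 0"
    "\<And>G. \<forall>z. dist (G z) (rot_conj K' a' z) \<le> \<eta>1 \<Longrightarrow> eps_transitive G (3 / real (n + 1))" by auto
  define \<eta>' where "\<eta>' = min \<eta>1 (\<eta> / 2)"
  have qa': "real q' * a' \<in> \<int>"
  proof -
    have "real q' * a' = real L * (real q * a) + 1" using qq q by (simp add: a'_def q'_def field_simps)
    then show ?thesis using q(2) by (metis Ints_1 Ints_add Ints_mult Ints_of_nat)
  qed
  have close: "dist (rot_conj K' (b + c) z) (rot_conj K b z) \<le> \<eta> / 2"
    if "real q * b \<in> \<int>" "\<bar>c\<bar> \<le> 1 / real q'" for b c z
  proof -
    have "rot_conj K b z = rot_conj K' b z"
      unfolding K'_def rot_conj_compose_twist[OF K q(1) that(1)] ..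
    moreover have "dist (rot_conj K' (b + c) z) (rot_conj K' b z) < e"
      unfolding rot_conj_def
    proof (rule d(2))
      have "dist (inv K' z + vector [b + c, 0]) (inv K' z + vector [b, 0]) = norm (vector [c, 0] :: real^2)"
        by (simp add: dist_norm) (rule arg_cong[where f=norm], simp add: vec_eq_iff forall_2)
      also have "\<dots> \<le> 1 / real q'" using norm_vec2_le[of "vector [c, 0]"] that(2) by simp
      also have "\<dots> < d" using small qq by (smt (verit) divide_right_mono of_nat_0_le_iff)
      finally show "dist (inv K' z + vector [b + c, 0]) (inv K' z + vector [b, 0]) < d" .
    qed
    ultimately show ?thesis using e by simp
  qed
  have "stage (Suc n) (K', a', q', \<eta>')"
    unfolding stage_def
  proof (simp only: prod.case, intro conjI allI impI K' qq qa')
    show "0 < \<eta>'" using \<eta>1 \<eta> by (simp add: \<eta>'_def)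
    show "dist (K' x) (K' y) < 1 / real (Suc n + 1)" if "dist x y \<le> 2 / real q'" for x y
      using d(2)[of x y] that small e(2) by simp
  qed
  moreover have "next_stage s n S (K', a', q', \<eta>')"
    unfolding next_stage_def S
  proof (simp only: prod.case, intro conjI allI impI K'_def a'_def qq)
    show "\<eta>' \<le> \<eta> / 2" by (simp add: \<eta>'_def)
    show "dist (rot_conj K' a' z) (rot_conj K a z) \<le> \<eta> / 2" for z
      unfolding a'_def by (rule close) (use q in auto)
    show "dist (rot_conj K' (- a') z) (rot_conj K (- a) z) \<le> \<eta> / 2" for z
      using close[of "- a" "- (1 / real q')" z] q by (simp add: a'_def)
    show "eps_transitive G (3 / real (n + 1))" if "\<forall>z. dist (G z) (rot_conj K' a' z) \<le> \<eta>'" for G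
      using that by (intro \<eta>1) (auto simp: \<eta>'_def)
  qed
  ultimately show ?thesis by blast
qed

lemma admissible_id: "admissible id"
  unfolding admissible_def
proof (intro conjI exI[of _ id] exI[of _ 1])
  show "homeomorphism UNIV UNIV (id::real^2 \<Rightarrow> real^2) id" by (rule homeomorphismI) auto
qed (auto simp: lattice_equivariant_def lebesgue_preserving_def)

lemma stages_exist:
  assumes s: "\<bar>s\<bar> \<le> 1"
  obtains K a q \<eta> where "\<And>n. stage n (K n, a n, q n, \<eta> n)"
    "\<And>n. next_stage s n (K n, a n, q n, \<eta> n) (K (Suc n), a (Suc n), q (Suc n), \<eta> (Suc n))"
    "K 0 = id"
proof -
  have "\<exists>f. \<forall>n. (stage n (f n) \<and> (n = 0 \<longrightarrow> fst (f n) = id)) \<and> next_stage s n (f n) (f (Suc n))"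
  proof (rule dependent_nat_choice)
    show "\<exists>x. stage 0 x \<and> (0 = (0::nat) \<longrightarrow> fst x = id)"
      by (intro exI[of _ "(id, 0, 4, 1)"]) (auto simp: stage_def admissible_id)
    show "\<exists>y. (stage (Suc n) y \<and> (Suc n = 0 \<longrightarrow> fst y = id)) \<and> next_stage s n x y"
      if "stage n x \<and> (n = 0 \<longrightarrow> fst x = id)" for x n
      using next_stage_exists[OF s, of n x] that by auto
  qed
  then obtain f where f: "\<And>n. stage n (f n)" "\<And>n. next_stage s n (f n) (f (Suc n))" "fst (f 0) = id"
    by blast
  show thesis
    by (rule that[of "\<lambda>n. fst (f n)" "\<lambda>n. fst (snd (f n))" "\<lambda>n. fst (snd (snd (f n)))" "\<lambda>n. snd (snd (snd (f n)))"])
       (use f in simp_all)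
qed

section \<open>The limit map\<close>

lemma rapidly_cauchy_limit:
  fixes f :: "nat \<Rightarrow> 'a \<Rightarrow> 'b::complete_space" and e :: "nat \<Rightarrow> real"
  assumes step: "\<And>n z. dist (f (Suc n) z) (f n z) \<le> e n - e (Suc n)" and e: "\<And>n. e n \<ge> 0" "e \<longlonglongrightarrow> 0"
  obtains F where "\<And>n z. dist (F z) (f n z) \<le> e n" "\<And>z. (\<lambda>n. f n z) \<longlonglongrightarrow> F z"
proof -
  have near: "dist (f m z) (f n z) \<le> e n - e m" if "n \<le> m" for m n z
    using that
  proof (induction m rule: dec_induct)
    case (step m)
    then show ?case
      using assms(1)[of m z] dist_triangle[of "f (Suc m) z" "f n z" "f m z"] by linarith
  qed simp
  have "Cauchy (\<lambda>n. f n z)" for z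
  proof (rule metric_CauchyI)
    fix r :: real assume "0 < r"
    then have "\<forall>\<^sub>F n in sequentially. e n < r / 2" using e(2) by (intro order_tendstoD) auto
    then obtain N where N: "e N < r / 2" by (auto simp: eventually_sequentially)
    show "\<exists>M. \<forall>m\<ge>M. \<forall>n\<ge>M. dist (f m z) (f n z) < r"
    proof (intro exI[of _ N] allI impI)
      fix m n assume "N \<le> m" "N \<le> n"
      then show "dist (f m z) (f n z) < r"
        using near[of N m z] near[of N n z] dist_triangle2[of "f m z" "f n z" "f N z"] e(1)[of m] e(1)[of n] N
        by linarith
    qed
  qed
  then have "\<exists>l. (\<lambda>n. f n z) \<longlonglongrightarrow> l" for z
    using Cauchy_convergent_iff convergent_def by blast
  then obtain F where F: "\<And>z. (\<lambda>n. f n z) \<longlonglongrightarrow> F z" by metis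
  have "dist (F z) (f n z) \<le> e n" for n z
  proof (rule tendsto_upperbound[where F = sequentially])
    show "((\<lambda>m. dist (f m z) (f n z)) \<longlongrightarrow> dist (F z) (f n z)) sequentially"
      by (intro tendsto_intros F)
    show "\<forall>\<^sub>F m in sequentially. dist (f m z) (f n z) \<le> e n"
      using eventually_ge_at_top[of n]
    proof eventually_elim
      case (elim m)
      then show ?case using near[OF elim, of z] e(1)[of m] by linarith
    qed
  qed simp
  then show thesis using that F by blast
qed

text \<open>By Fatou's lemma a pointwise limit can only lose measure on open sets; for a homeomorphism
  the same bound for the inverse closes the gap.\<close>
lemma emeasure_vimage_limit_le:
  fixes F :: "'a::euclidean_space \<Rightarrow> 'a"
  assumes f: "\<And>n. lebesgue_preserving (f n)" and F: "F \<in> borel_measurable borel"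
    and lim: "\<And>z. (\<lambda>n. f n z) \<longlonglongrightarrow> F z" and U: "open U"
  shows "emeasure lborel (F -` U) \<le> emeasure lborel U"
proof -
  have m: "f n \<in> borel_measurable borel" for n using f by (simp add: lebesgue_preserving_def)
  have Ub: "U \<in> sets borel" using U by simp
  have meas: "(\<lambda>z. indicator U (g z) :: ennreal) \<in> borel_measurable borel"
    if "g \<in> borel_measurable borel" for g :: "'a \<Rightarrow> 'a"
    using that Ub by (intro measurable_compose[OF that] borel_measurable_indicator) 
  have int: "(\<integral>\<^sup>+z. indicator U (g z) \<partial>lborel) = emeasure lborel (g -` U)"
    if "g \<in> borel_measurable borel" for g :: "'a \<Rightarrow> 'a"
  proof -
    have "g -` U \<in> sets borel" using measurable_sets[OF that Ub] by simp
    then show ?thesis by (simp add: indicator_vimage[symmetric] flip: nn_integral_indicator)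
  qed
  have "emeasure lborel (F -` U) = (\<integral>\<^sup>+z. indicator U (F z) \<partial>lborel)" by (simp add: int F)
  also have "\<dots> \<le> (\<integral>\<^sup>+z. liminf (\<lambda>n. indicator U (f n z)) \<partial>lborel)"
  proof (rule nn_integral_mono)
    fix z
    show "(indicator U (F z) :: ennreal) \<le> liminf (\<lambda>n. indicator U (f n z))"
    proof (cases "F z \<in> U")
      case True
      then have "\<forall>\<^sub>F n in sequentially. f n z \<in> U" using topological_tendstoD[OF lim U] by simp
      then show ?thesis by (intro Liminf_bounded) (auto elim!: eventually_mono simp: True indicator_def)
    qed simp
  qed
  also have "\<dots> \<le> liminf (\<lambda>n. \<integral>\<^sup>+z. indicator U (f n z) \<partial>lborel)"
    by (rule nn_integral_liminf) (use meas[OF m] in simp)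
  also have "\<dots> = emeasure lborel U"
    using lebesgue_preservingD[OF f Ub] by (simp add: int m Liminf_const)
  finally show ?thesis .
qed

lemma lebesgue_preserving_limit:
  fixes F :: "'a::euclidean_space \<Rightarrow> 'a"
  assumes FG: "homeomorphism UNIV UNIV F G"
    and f: "\<And>n. lebesgue_preserving (f n)" "\<And>z. (\<lambda>n. f n z) \<longlonglongrightarrow> F z"
    and g: "\<And>n. lebesgue_preserving (g n)" "\<And>z. (\<lambda>n. g n z) \<longlonglongrightarrow> G z"
  shows "lebesgue_preserving F"
proof (rule lebesgue_preserving_openI)
  have cont: "continuous_on UNIV F" "continuous_on UNIV G" using FG by (auto simp: homeomorphism_def)
  show m: "F \<in> borel_measurable borel" by (rule borel_measurable_continuous_onI[OF cont(1)])
  fix U :: "'a set" assume U: "open U"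
  have "emeasure lborel (G -` (F -` U)) \<le> emeasure lborel (F -` U)"
    by (rule emeasure_vimage_limit_le[OF g(1) borel_measurable_continuous_onI[OF cont(2)] g(2)])
       (use U cont(1) in \<open>simp add: continuous_on_open_vimage\<close>)
  then have "emeasure lborel U \<le> emeasure lborel (F -` U)"
    by (simp add: vimage_def homeomorphism_UNIV_inv[OF FG])
  moreover have "emeasure lborel (F -` U) \<le> emeasure lborel U"
    by (rule emeasure_vimage_limit_le[OF f(1) m f(2) U])
  ultimately show "emeasure lborel (F -` U) = emeasure lborel U" by (rule order.antisym[rotated])
qed

lemma open_off_lines: "open {z::real^2. z$2 \<notin> \<int>}"
proof -
  have "closed ((\<lambda>z::real^2. z$2) -` \<int>)"
    by (rule closed_vimage[OF closed_Ints]) (intro continuous_intros)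
  moreover have "{z::real^2. z$2 \<notin> \<int>} = - ((\<lambda>z. z$2) -` \<int>)" by auto
  ultimately show ?thesis by (simp add: open_Compl)
qed

lemma isCont_strip_coord: "z$2 \<notin> \<int> \<Longrightarrow> isCont (strip_coord s) z"
  unfolding strip_coord_def[abs_def]
  by (auto intro!: continuous_intros isCont_o2[OF _ continuous_frac])

text \<open>Let \<open>K n\<close> be the conjugacies, \<open>a n\<close> the translation lengths, and \<open>C n\<close> the strip
  coordinate composed with the inverse of \<open>K n\<close>. The conjugates converge uniformly by the choice
  of tolerances, and the functions \<open>C n\<close> converge uniformly since the \<open>n\<close>-th twist moves the
  strip coordinate by at most \<open>1 / q n\<close>. The equation
  \<open>C n \<circ> rot_conj (K n) (a n) = C n + a n\<close> passes to the limit. The function \<open>c\<close> obtained would define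
  a semiconjugacy to the rotation by \<open>\<alpha>\<close>, were it not for its discontinuity at integer heights,
  where it is asymptotic to the strip coordinate.\<close>
lemma limit_map:
  assumes s: "\<bar>s\<bar> \<le> 1"
  obtains F G :: "real^2 \<Rightarrow> real^2" and c \<alpha> where
    "homeomorphism UNIV UNIV F G" "lattice_equivariant F" "lebesgue_preserving F"
    "\<And>e. e > 0 \<Longrightarrow> eps_transitive F e"
    "\<And>z. c (F z) = c z + \<alpha>" "\<And>z k. k \<in> int_lattice \<Longrightarrow> c (z + k) = c z + k$1"
    "\<And>z. z$2 \<notin> \<int> \<Longrightarrow> isCont c z"
    "\<And>e. e > 0 \<Longrightarrow> \<exists>\<delta>>0. \<forall>z. 1/2 - \<delta> \<le> \<bar>frac (z$2) - 1/2\<bar> \<longrightarrow> \<bar>c z - strip_coord s z\<bar> < e"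
    "\<And>z. \<bar>c z - strip_coord s z\<bar> \<le> 2"
    "\<And>z. z$2 \<in> \<int> \<Longrightarrow> F z = z + vector [\<alpha>, 0]"
    "\<And>z j. of_int j \<le> z$2 \<Longrightarrow> z$2 \<le> of_int j + 1 \<Longrightarrow> of_int j \<le> F z $ 2 \<and> F z $ 2 \<le> of_int j + 1"
proof -
  obtain K a q \<eta> where st: "\<And>n. stage n (K n, a n, q n, \<eta> n)"
    and nx: "\<And>n. next_stage s n (K n, a n, q n, \<eta> n) (K (Suc n), a (Suc n), q (Suc n), \<eta> (Suc n))"
    and K0: "K 0 = id" by (rule stages_exist[OF s]) blast
  have K: "admissible (K n)" and q: "q n > 0" and \<eta>0: "\<eta> n > 0" for n
    using st[of n] by (auto simp: stage_def)
  have KS: "K (Suc n) = K n \<circ> cell_twist s (q n) (profile (q n))" and aS: "a (Suc n) = a n + 1 / real (q (Suc n))"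
    and qS: "2 * q n \<le> q (Suc n)" and \<eta>S: "\<eta> (Suc n) \<le> \<eta> n / 2"
    and close: "dist (rot_conj (K (Suc n)) (a (Suc n)) z) (rot_conj (K n) (a n) z) \<le> \<eta> n / 2"
      "dist (rot_conj (K (Suc n)) (- a (Suc n)) z) (rot_conj (K n) (- a n) z) \<le> \<eta> n / 2"
    and trans: "(\<forall>z. dist (F z) (rot_conj (K (Suc n)) (a (Suc n)) z) \<le> \<eta> (Suc n)) \<Longrightarrow> eps_transitive F (3 / real (n + 1))"
    for n z F using nx[of n] by (auto simp: next_stage_def)
  define \<epsilon> where "\<epsilon> = (\<lambda>n. 2 * (1/2::real)^n)"
  have \<epsilon>: "\<epsilon> n \<ge> 0" "\<epsilon> \<longlonglongrightarrow> 0" for n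
    unfolding \<epsilon>_def by (auto intro!: tendsto_mult_right_zero LIMSEQ_power_zero)
  have q2: "1 / real (q n) \<le> \<epsilon> n - \<epsilon> (Suc n)" for n
  proof -
    have "2 ^ n \<le> q n"
    proof (induction n)
      case 0 then show ?case using q[of 0] by simp
    next
      case (Suc n) then show ?case using qS[of n] by simp
    qed
    then have "2 ^ n \<le> real (q n)" by (metis of_nat_le_iff of_nat_numeral of_nat_power)
    then have "1 / real (q n) \<le> 1 / 2 ^ n" by (intro divide_left_mono) (auto simp: q)
    then show ?thesis by (simp add: \<epsilon>_def power_one_over)
  qed
  have \<eta>lim: "\<eta> \<longlonglongrightarrow> 0"
  proof (rule tendsto_sandwich[OF _ _ tendsto_const])
    have "\<eta> n \<le> \<eta> 0 * (1/2)^n" for n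
    proof (induction n)
      case (Suc n) then show ?case using \<eta>S[of n] by simp
    qed simp
    then show "\<forall>\<^sub>F n in sequentially. \<eta> n \<le> \<eta> 0 * (1/2)^n" by simp
    show "(\<lambda>n. \<eta> 0 * (1/2)^n) \<longlonglongrightarrow> 0" by (auto intro!: tendsto_mult_right_zero LIMSEQ_power_zero)
  qed (use \<eta>0 in \<open>simp add: less_imp_le\<close>)
  define f g where "f = (\<lambda>n. rot_conj (K n) (a n))" and "g = (\<lambda>n. rot_conj (K n) (- a n))"
  have half: "\<eta> n / 2 \<le> \<eta> n - \<eta> (Suc n)" for n using \<eta>S[of n] by simp
  obtain F where F: "\<And>n z. dist (F z) (f n z) \<le> \<eta> n" "\<And>z. (\<lambda>n. f n z) \<longlonglongrightarrow> F z"
    by (rule rapidly_cauchy_limit[of f \<eta>])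
       (use order.trans[OF close(1) half] \<eta>0 \<eta>lim in \<open>auto simp: f_def less_imp_le\<close>)
  obtain G where G: "\<And>n z. dist (G z) (g n z) \<le> \<eta> n" "\<And>z. (\<lambda>n. g n z) \<longlonglongrightarrow> G z"
    by (rule rapidly_cauchy_limit[of g \<eta>])
       (use order.trans[OF close(2) half] \<eta>0 \<eta>lim in \<open>auto simp: g_def less_imp_le\<close>)
  have a_step: "dist (a (Suc n)) (a n) \<le> \<epsilon> n - \<epsilon> (Suc n)" for n
  proof -
    have "1 / real (q (Suc n)) \<le> 1 / real (q n)" using q[of n] qS[of n] by (intro divide_left_mono) auto
    then show ?thesis using q2[of n] by (simp add: aS dist_real_def)
  qed
  obtain \<alpha> where \<alpha>: "a \<longlonglongrightarrow> \<alpha>"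
    by (rule rapidly_cauchy_limit[of "\<lambda>n (z::unit). a n" \<epsilon>, OF a_step \<epsilon>]) blast
  define C where "C = (\<lambda>n z. strip_coord s (inv (K n) z))"
  have C_step: "dist (C (Suc n) z) (C n z) \<le> \<epsilon> n - \<epsilon> (Suc n)" for n z
  proof -
    interpret tw: twist_profile s "q n" "profile (q n)" "outer_radius (q n)" by (rule twist_profile_profile[OF q])
    note H = admissible_twist[OF q[of n], of s]
    define y where "y = inv (K (Suc n)) z"
    have "inv (K n) z = tw.h y"
      unfolding y_def KS admissible_compose(2)[OF K H] admissible_inv(3)[OF H] ..
    then have "dist (C (Suc n) z) (C n z) \<le> 1 / real (q n)"
      using tw.strip_coord_twist_le[of y] by (simp add: C_def y_def dist_real_def abs_minus_commute)
    then show ?thesis using q2[of n] by linarith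
  qed
  obtain c where c: "\<And>n z. dist (c z) (C n z) \<le> \<epsilon> n" "\<And>z. (\<lambda>n. C n z) \<longlonglongrightarrow> c z"
    by (rule rapidly_cauchy_limit[of C \<epsilon>]) (use C_step \<epsilon> in auto)
  have unif: "uniform_limit UNIV u U sequentially"
    if "\<And>n z. dist (U z) (u n z) \<le> r n" "r \<longlonglongrightarrow> 0" for u :: "nat \<Rightarrow> real^2 \<Rightarrow> 'b::metric_space" and U r
  proof (rule uniform_limitI)
    fix e :: real assume "e > 0"
    then have "\<forall>\<^sub>F n in sequentially. r n < e" using that(2) by (intro order_tendstoD) auto
    then show "\<forall>\<^sub>F n in sequentially. \<forall>z\<in>UNIV. dist (u n z) (U z) < e"
      by eventually_elim (use that(1) in \<open>metis dist_commute le_less_trans\<close>)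
  qed
  have contF: "continuous_on UNIV F"
    by (rule uniform_limit_theorem[OF _ unif[OF F(1) \<eta>lim]]) (auto simp: f_def continuous_rot_conj K)
  have contG: "continuous_on UNIV G"
    by (rule uniform_limit_theorem[OF _ unif[OF G(1) \<eta>lim]]) (auto simp: g_def continuous_rot_conj K)
  have fg: "f n (g n z) = z" "g n (f n z) = z" for n z
    by (simp_all add: f_def g_def rot_conj_add rot_conj_0 K)
  have GF: "G (F z) = z" for z
  proof (rule LIMSEQ_unique)
    have "isCont G (F z)" using contG by (simp add: continuous_on_eq_continuous_at)
    then show "(\<lambda>n. G (f n z)) \<longlonglongrightarrow> G (F z)" by (rule isCont_tendsto_compose) (rule F(2))
    have "dist (G (f n z)) z \<le> \<eta> n" for n using G(1)[of "f n z" n] by (simp add: fg)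
    then have "(\<lambda>n. dist (G (f n z)) z) \<longlonglongrightarrow> 0"
      by (intro tendsto_sandwich[OF _ _ tendsto_const \<eta>lim]) auto
    then show "(\<lambda>n. G (f n z)) \<longlonglongrightarrow> z" by (rule tendsto_dist_iff[THEN iffD2])
  qed
  have FG: "F (G z) = z" for z
  proof (rule LIMSEQ_unique)
    have "isCont F (G z)" using contF by (simp add: continuous_on_eq_continuous_at)
    then show "(\<lambda>n. F (g n z)) \<longlonglongrightarrow> F (G z)" by (rule isCont_tendsto_compose) (rule G(2))
    have "dist (F (g n z)) z \<le> \<eta> n" for n using F(1)[of "g n z" n] by (simp add: fg)
    then have "(\<lambda>n. dist (F (g n z)) z) \<longlonglongrightarrow> 0"
      by (intro tendsto_sandwich[OF _ _ tendsto_const \<eta>lim]) auto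
    then show "(\<lambda>n. F (g n z)) \<longlonglongrightarrow> z" by (rule tendsto_dist_iff[THEN iffD2])
  qed
  have hom: "homeomorphism UNIV UNIV F G"
    by (rule homeomorphismI) (auto simp: contF contG GF FG)
  have lines: "F z = z + vector [\<alpha>, 0]" if "z$2 \<in> \<int>" for z
  proof (rule LIMSEQ_unique[OF F(2)])
    have "(\<lambda>n. z + a n *\<^sub>R vector [1, 0]) \<longlonglongrightarrow> z + \<alpha> *\<^sub>R vector [1, 0]"
      by (intro tendsto_intros \<alpha>)
    moreover have "b *\<^sub>R vector [1, 0] = (vector [b, 0] :: real^2)" for b
      by (simp add: vec_eq_iff forall_2)
    ultimately show "(\<lambda>n. f n z) \<longlonglongrightarrow> z + vector [\<alpha>, 0]"
      using that by (simp add: f_def rot_conj_properties(4)[OF K])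
  qed
  \<comment> \<open>the lines of integer height are invariant and \<open>F\<close> is injective\<close>
  have off: "F z $ 2 \<notin> \<int>" if "z$2 \<notin> \<int>" for z
  proof
    assume Fz: "F z $ 2 \<in> \<int>"
    then have "F (F z - vector [\<alpha>, 0]) = F z" by (subst lines) auto
    then have "z = F z - vector [\<alpha>, 0]" by (metis GF)
    then have "z$2 = F z $ 2" by (metis diff_zero vector_2(2) vector_minus_component)
    then show False using Fz that by simp
  qed
  have C_f: "C n (f n z) = C n z + a n" for n z
    using strip_coord_def by (simp add: C_def f_def rot_conj_def admissible_inv[OF K])
  have C_lines: "C n z = strip_coord s z" if "z$2 \<in> \<int>" for n z
    unfolding C_def admissibleD(5)[OF admissible_inv(1)[OF K] that] ..
  have c_lines: "c z = strip_coord s z" if "z$2 \<in> \<int>" for z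
    using c(2)[of z] LIMSEQ_unique[OF _ tendsto_const] by (simp add: C_lines[OF that])
  have contC: "continuous_on {z. z$2 \<notin> \<int>} (C n)" for n
  proof (rule continuous_at_imp_continuous_on, rule ballI)
    fix z :: "real^2" assume "z \<in> {z. z$2 \<notin> \<int>}"
    then have z: "z$2 \<notin> \<int>" by simp
    have "inv (K n) z $ 2 \<notin> \<int>"
    proof
      assume i: "inv (K n) z $ 2 \<in> \<int>"
      from admissibleD(5)[OF K[of n] i] have "inv (K n) z = z" by (simp add: admissible_inv[OF K])
      then show False using i z by simp
    qed
    moreover have "isCont (inv (K n)) z"
      using admissibleD(1)[OF admissible_inv(1)[OF K[of n]]] by (simp add: continuous_on_eq_continuous_at)
    ultimately show "isCont (C n) z"
      unfolding C_def using isCont_strip_coord isCont_o2 by blast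
  qed
  have "continuous_on {z. z$2 \<notin> \<int>} c"
    by (rule uniform_limit_theorem[OF _ uniform_limit_on_subset[OF unif[OF c(1) \<epsilon>(2)]]])
       (auto simp: contC)
  then have contc: "isCont c z" if "z$2 \<notin> \<int>" for z
    using that open_off_lines by (simp add: continuous_on_eq_continuous_at)
  have c_F: "c (F z) = c z + \<alpha>" for z
  proof (cases "z$2 \<in> \<int>")
    case True
    then show ?thesis by (simp add: c_lines lines strip_coord_def)
  next
    case False
    show ?thesis
    proof (rule LIMSEQ_unique)
      show "(\<lambda>n. c (f n z)) \<longlonglongrightarrow> c (F z)"
        by (rule isCont_tendsto_compose[OF contc[OF off[OF False]] F(2)])
      have "norm (c (f n z) - C n (f n z)) \<le> \<epsilon> n" for n
        using c(1)[of "f n z" n] by (simp add: dist_real_def)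
      then have "(\<lambda>n. c (f n z) - C n (f n z)) \<longlonglongrightarrow> 0"
        by (intro Lim_null_comparison[OF _ \<epsilon>(2)]) auto
      from tendsto_add[OF this tendsto_add[OF c(2)[of z] \<alpha>]]
      show "(\<lambda>n. c (f n z)) \<longlonglongrightarrow> c z + \<alpha>" by (simp add: C_f)
    qed
  qed
  show thesis
  proof (rule that[OF hom _ _ _ c_F _ contc _ _ lines])
    show "lattice_equivariant F"
      unfolding lattice_equivariant_def
    proof (intro allI ballI)
      fix z k :: "real^2" assume k: "k \<in> int_lattice"
      show "F (z + k) = F z + k"
      proof (rule LIMSEQ_unique[OF F(2)])
        have "(\<lambda>n. f n z + k) \<longlonglongrightarrow> F z + k" by (intro tendsto_intros F(2))
        then show "(\<lambda>n. f n (z + k)) \<longlonglongrightarrow> F z + k"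
          using lattice_equivariantD[OF rot_conj_properties(1)[OF K] k] by (simp add: f_def)
      qed
    qed
    show "lebesgue_preserving F"
      by (rule lebesgue_preserving_limit[OF hom _ F(2) _ G(2)])
         (auto simp: f_def g_def rot_conj_properties(2)[OF K])
    show "eps_transitive F e" if "e > 0" for e
    proof -
      obtain n where n: "3 / e < real n" using reals_Archimedean2 by blast
      then have "3 / real (n + 1) < e" using that by (simp add: field_simps)
      moreover have "eps_transitive F (3 / real (n + 1))"
        by (rule trans) (use F(1)[of _ "Suc n"] in \<open>simp add: f_def\<close>)
      ultimately show ?thesis unfolding eps_transitive_def by (meson less_trans)
    qed
    show "c (z + k) = c z + k$1" if k: "k \<in> int_lattice" for z k
    proof (rule LIMSEQ_unique[OF c(2)])
      have "(\<lambda>n. C n z + k$1) \<longlonglongrightarrow> c z + k$1" by (intro tendsto_intros c(2))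
      then show "(\<lambda>n. C n (z + k)) \<longlonglongrightarrow> c z + k$1"
        using lattice_equivariantD[OF admissibleD(2)[OF admissible_inv(1)[OF K]] k]
        by (simp add: C_def strip_coord_lattice[OF k])
    qed
    show "\<exists>\<delta>>0. \<forall>z. 1/2 - \<delta> \<le> \<bar>frac (z$2) - 1/2\<bar> \<longrightarrow> \<bar>c z - strip_coord s z\<bar> < e" if "e > 0" for e
    proof -
      have "\<forall>\<^sub>F n in sequentially. \<epsilon> n < e" using \<epsilon>(2) that by (intro order_tendstoD) auto
      then obtain n where n: "\<epsilon> n < e" by (auto simp: eventually_sequentially)
      obtain \<delta> where "\<delta> > 0" and \<delta>: "\<And>z. 1/2 - \<delta> \<le> \<bar>frac (z$2) - 1/2\<bar> \<Longrightarrow> inv (K n) z = z"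
        using admissible_inv(1)[OF K[of n]] unfolding admissible_def by metis
      have "\<bar>c z - strip_coord s z\<bar> < e" if "1/2 - \<delta> \<le> \<bar>frac (z$2) - 1/2\<bar>" for z
        using c(1)[of z n] n \<delta>[OF that] by (simp add: C_def dist_real_def)
      then show ?thesis using \<open>\<delta> > 0\<close> by blast
    qed
    show "\<bar>c z - strip_coord s z\<bar> \<le> 2" for z
      using c(1)[of z 0] by (simp add: C_def K0 \<epsilon>_def dist_real_def inv_id)
    show "of_int j \<le> F z $ 2 \<and> F z $ 2 \<le> of_int j + 1"
      if "of_int j \<le> z$2" "z$2 \<le> of_int j + 1" for z j
    proof (cases "z$2 = of_int j + 1")
      case True
      then have "z$2 \<in> \<int>" by simp
      then show ?thesis using lines[of z] True by simp
    next
      case False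
      then have "\<lfloor>z$2\<rfloor> = j" using that by (intro floor_unique) auto
      then have "of_int j \<le> f n z $ 2" "f n z $ 2 \<le> of_int j + 1" for n
        using rot_conj_properties(3)[OF K, of n "a n" z] unfolding f_def by linarith+
      moreover have "(\<lambda>n. f n z $ 2) \<longlonglongrightarrow> F z $ 2" by (intro tendsto_intros F(2))
      ultimately show ?thesis
        using LIMSEQ_le_const[of "\<lambda>n. f n z $ 2"] LIMSEQ_le_const2[of "\<lambda>n. f n z $ 2"] by blast
    qed
  qed
qed

section \<open>A dense orbit\<close>

lemma lattice_equivariant_funpow:
  "lattice_equivariant F \<Longrightarrow> k \<in> int_lattice \<Longrightarrow> (F ^^ n) (z + k) = (F ^^ n) z + k"
  by (induction n) (auto simp: lattice_equivariantD)

lemma continuous_on_funpow: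
  fixes F :: "'a::topological_space \<Rightarrow> 'a"
  shows "continuous_on UNIV F \<Longrightarrow> continuous_on UNIV (F ^^ n)"
proof (induction n)
  case (Suc n)
  then show ?case using continuous_on_compose2[of UNIV F UNIV "F ^^ n"] by (simp add: comp_def)
qed (simp add: id_def)

text \<open>Baire's theorem: for each basic open set, the points that enter its lattice translates
  form an open set, which is dense since an orbit visits a given ball first and that set later.\<close>
lemma dense_orbit_exists:
  assumes eq: "lattice_equivariant F" and cont: "continuous_on UNIV F"
    and trans: "\<And>e. e > 0 \<Longrightarrow> eps_transitive F e"
  shows "\<exists>z. \<forall>w e. 0 < e \<longrightarrow> (\<exists>j. \<exists>k\<in>int_lattice. dist ((F ^^ j) z + k) w < e)"
proof -
  obtain B :: "(real^2) set set" where B: "countable B" "topological_basis B"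
    using ex_countable_basis by blast
  define W where "W = (\<lambda>V. \<Union>j. \<Union>k\<in>int_lattice. (\<lambda>z. (F ^^ j) z + k) -` V)"
  have W: "open (W V)" if "open V" for V
    unfolding W_def
  proof (intro open_UN ballI)
    fix j and k :: "real^2"
    have "continuous_on UNIV (\<lambda>z. (F ^^ j) z + k)"
      by (intro continuous_intros continuous_on_funpow cont)
    then show "open ((\<lambda>z. (F ^^ j) z + k) -` V)"
      using that by (simp add: continuous_on_open_vimage)
  qed
  have dense: "UNIV \<subseteq> closure (W V)" if V: "open V" "V \<noteq> {}" for V
  proof
    fix x :: "real^2"
    obtain v r where r: "r > 0" "ball v r \<subseteq> V" using V by (metis openE ex_in_conv)
    show "x \<in> closure (W V)"
      unfolding closure_approachable
    proof (intro allI impI)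
      fix e :: real assume "0 < e"
      then have "eps_transitive F (min e r)" using r by (intro trans) simp
      then obtain z i j k l where kl: "k \<in> int_lattice" "l \<in> int_lattice" "i \<le> j"
        and d: "dist ((F ^^ i) z + k) x < min e r" "dist ((F ^^ j) z + l) v < min e r"
        unfolding eps_transitive_def by meson
      have "(F ^^ (j - i)) ((F ^^ i) z + k) = (F ^^ j) z + k"
        using kl(3) by (simp add: lattice_equivariant_funpow[OF eq kl(1)] flip: funpow_add[unfolded comp_def fun_eq_iff, rule_format])
      then have "(F ^^ (j - i)) ((F ^^ i) z + k) + (l - k) \<in> V"
        using d(2) r(2) by (auto simp: dist_commute)
      then have "(F ^^ i) z + k \<in> W V"
        using int_lattice_diff[OF kl(2,1)] unfolding W_def by blast
      then show "\<exists>y\<in>W V. dist y x < e" using d(1) by auto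
    qed
  qed
  have open_B: "open V" if "V \<in> B" for V using B(2) that topological_basis_open by blast
  have "UNIV \<subseteq> closure (\<Inter>(W ` (B - {{}})))"
  proof (rule Baire)
    show "countable (W ` (B - {{}}))" using B(1) by simp
    fix T assume "T \<in> W ` (B - {{}})"
    then show "openin (top_of_set UNIV) T \<and> UNIV \<subseteq> closure T"
      using W dense open_B by auto
  qed simp
  then obtain z where z: "z \<in> \<Inter>(W ` (B - {{}}))" by (metis UNIV_I closure_empty empty_iff ex_in_conv subsetD)
  have "\<exists>j. \<exists>k\<in>int_lattice. dist ((F ^^ j) z + k) w < e" if "0 < e" for w e
  proof -
    obtain V where V: "V \<in> B" "w \<in> V" "V \<subseteq> ball w e"
      by (rule topological_basisE[OF B(2), of "ball w e" w]) (use \<open>0 < e\<close> in auto)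
    then have "z \<in> W V" using z by blast
    then obtain j k where "k \<in> int_lattice" "(F ^^ j) z + k \<in> V" by (auto simp: W_def)
    moreover from this have "dist ((F ^^ j) z + k) w < e" using V(3) by (auto simp: dist_commute)
    ultimately show ?thesis by blast
  qed
  then show ?thesis by blast
qed

section \<open>Rigidity at the boundary of a strip\<close>

text \<open>The embedding of the circle into the complex plane; the arbitrary representative is
  immaterial by periodicity. Circle-valued maps become functions that can be multiplied.\<close>
definition circle_char :: "real torus \<Rightarrow> complex" where
  "circle_char t = cis (2 * pi * (SOME x. torus_proj x = t))"

lemma int_lattice_real: "x \<in> (int_lattice :: real set) \<longleftrightarrow> x \<in> \<int>"
  by (simp add: int_lattice_def)

lemma cis_2pi_Ints: "k \<in> \<int> \<Longrightarrow> cis (2 * pi * (x + k)) = cis (2 * pi * x)"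
  by (simp add: distrib_left flip: cis_mult)

lemma circle_char_proj: "circle_char (torus_proj x) = cis (2 * pi * x)"
proof -
  define y where "y = (SOME y. torus_proj y = torus_proj x)"
  have "torus_proj y = torus_proj x" unfolding y_def by (rule someI) (rule refl)
  then have "y - x \<in> \<int>" by (simp add: torus_proj_eq_iff int_lattice_real)
  then have "cis (2 * pi * (x + (y - x))) = cis (2 * pi * x)" by (rule cis_2pi_Ints)
  then show ?thesis by (simp add: circle_char_def flip: y_def)
qed

lemma continuous_circle_char: "continuous_on UNIV circle_char"
proof -
  have "open (circle_char -` U)" if "open U" for U
  proof -
    have "torus_proj -` (circle_char -` U) = (\<lambda>x. cis (2 * pi * x)) -` U"
      by (auto simp: circle_char_proj)
    moreover have "continuous_on UNIV (\<lambda>x. cis (2 * pi * x))"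
      unfolding cis_conv_exp by (intro continuous_intros)
    ultimately show ?thesis using that by (simp add: open_torus_def continuous_on_open_vimage)
  qed
  then show ?thesis by (simp add: continuous_on_open_vimage)
qed

lemma circle_rotation_proj: "circle_rotation a (torus_proj x) = torus_proj (x + a)"
  by transfer (simp add: torus_rel_def int_lattice_def)

lemma circle_char_rotation: "circle_char (circle_rotation a t) = cis (2 * pi * a) * circle_char t"
proof -
  obtain x where "t = torus_proj x" using surj_torus_proj by blast
  then show ?thesis
    by (simp add: circle_rotation_proj circle_char_proj cis_mult distrib_left add.commute)
qed

lemma norm_circle_char: "norm (circle_char t) = 1"
  by (simp add: circle_char_def)

lemma boundary_values:
  assumes near: "\<And>e. e > 0 \<Longrightarrow> \<exists>\<delta>>0. \<forall>z. 1/2 - \<delta> \<le> \<bar>frac (z$2) - 1/2\<bar> \<longrightarrow> \<bar>c z - strip_coord s z\<bar> < e"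
  shows "(\<lambda>n. c (vector [x, 1 / real (n + 3)])) \<longlonglongrightarrow> x"
    and "(\<lambda>n. c (vector [x, 1 - 1 / real (n + 3)])) \<longlonglongrightarrow> x + s"
proof -
  have y0: "(\<lambda>n. 1 / real (n + 3)) \<longlonglongrightarrow> 0"
    using LIMSEQ_ignore_initial_segment[OF lim_1_over_n, of 3] by simp
  have y: "0 < 1 / real (n + 3)" "1 / real (n + 3) < 1/2" for n by (auto simp: field_simps)
  have fr: "frac (1 / real (n + 3)) = 1 / real (n + 3)" "frac (1 - 1 / real (n + 3)) = 1 - 1 / real (n + 3)" for n
    using y[of n] by (intro frac_eq[THEN iffD2]; linarith)+
  have diff: "(\<lambda>n. c (w n) - strip_coord s (w n)) \<longlonglongrightarrow> 0"
    if w: "\<And>n. \<bar>frac (w n $ 2) - 1/2\<bar> = 1/2 - 1 / real (n + 3)" for w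
  proof (rule tendstoI)
    fix e :: real assume "e > 0"
    then obtain \<delta> where \<delta>: "\<delta> > 0" "\<And>z. 1/2 - \<delta> \<le> \<bar>frac (z$2) - 1/2\<bar> \<Longrightarrow> \<bar>c z - strip_coord s z\<bar> < e"
      using near by blast
    have "\<forall>\<^sub>F n in sequentially. 1 / real (n + 3) < \<delta>" using y0 \<delta>(1) by (intro order_tendstoD) auto
    then show "\<forall>\<^sub>F n in sequentially. dist (c (w n) - strip_coord s (w n)) 0 < e"
    proof eventually_elim
      case (elim n)
      then show ?case using \<delta>(2)[of "w n"] w[of n] by simp
    qed
  qed
  have "(\<lambda>n. x + s * (1 / real (n + 3))) \<longlonglongrightarrow> x + s * 0" by (intro tendsto_intros y0)
  from tendsto_add[OF diff[of "\<lambda>n. vector [x, 1 / real (n + 3)]"] this]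
  show "(\<lambda>n. c (vector [x, 1 / real (n + 3)])) \<longlonglongrightarrow> x"
    using y by (simp add: strip_coord_def fr del: of_nat_add)
  have "(\<lambda>n. x + s * (1 - 1 / real (n + 3))) \<longlonglongrightarrow> x + s * (1 - 0)" by (intro tendsto_intros y0)
  from tendsto_add[OF diff[of "\<lambda>n. vector [x, 1 - 1 / real (n + 3)]"] this]
  show "(\<lambda>n. c (vector [x, 1 - 1 / real (n + 3)])) \<longlonglongrightarrow> x + s"
    using y by (simp add: strip_coord_def fr del: of_nat_add)
qed

lemma invariant_constant_off_lines:
  fixes E :: "real^2 \<Rightarrow> complex"
  assumes dense: "\<And>w e. 0 < e \<Longrightarrow> \<exists>j. \<exists>k\<in>int_lattice. dist ((F ^^ j) z\<^sub>0 + k) w < e"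
    and inv: "\<And>z. E (F z) = E z" "\<And>z k. k \<in> int_lattice \<Longrightarrow> E (z + k) = E z"
    and cont: "isCont E w"
  shows "E w = E z\<^sub>0"
proof (rule ccontr)
  assume "E w \<noteq> E z\<^sub>0"
  then have "0 < dist (E w) (E z\<^sub>0)" by simp
  then obtain d where d: "d > 0" "\<And>x. dist x w < d \<Longrightarrow> dist (E x) (E w) < dist (E w) (E z\<^sub>0)"
    using cont unfolding continuous_at_eps_delta by blast
  have "E ((F ^^ j) z\<^sub>0) = E z\<^sub>0" for j by (induction j) (auto simp: inv)
  then show False using dense[OF d(1), of w] d(2) inv(2) by (metis dist_commute less_irrefl)
qed

text \<open>The product of \<open>u\<close> and \<open>m \<circ> c\<close> is invariant, and continuous away from integer heights,
  hence constant there. Its limits at height \<open>0\<close> from above and at height \<open>1\<close> from below involve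
  the same values of \<open>u\<close>, by periodicity, but values of \<open>m\<close> that are shifted by \<open>s\<close>.\<close>
lemma boundary_rigidity:
  fixes u :: "real^2 \<Rightarrow> complex" and m :: "real \<Rightarrow> complex"
  assumes dense: "\<And>w e. 0 < e \<Longrightarrow> \<exists>j. \<exists>k\<in>int_lattice. dist ((F ^^ j) z\<^sub>0 + k) w < e"
    and c: "\<And>z. c (F z) = c z + \<alpha>" "\<And>z k. k \<in> int_lattice \<Longrightarrow> c (z + k) = c z + k$1"
      "\<And>z. z$2 \<notin> \<int> \<Longrightarrow> isCont c z"
      "\<And>e. e > 0 \<Longrightarrow> \<exists>\<delta>>0. \<forall>z. 1/2 - \<delta> \<le> \<bar>frac (z$2) - 1/2\<bar> \<longrightarrow> \<bar>c z - strip_coord s z\<bar> < e"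
    and u: "continuous_on UNIV u" "\<And>z k. k \<in> int_lattice \<Longrightarrow> u (z + k) = u z" "\<And>z. u (F z) = a * u z"
    and m: "continuous_on UNIV m" "\<And>t k. k \<in> \<int> \<Longrightarrow> m (t + k) = m t" "\<And>t. m (t + \<alpha>) = b * m t"
    and ab: "a * b = 1"
  shows "\<exists>e. \<forall>x. u (vector [x, 0]) * m x = e \<and> u (vector [x, 0]) * m (x + s) = e"
proof -
  define E where "E = (\<lambda>z. u z * m (c z))"
  have uc: "isCont u z" and mc: "isCont m t" for z t
    using u(1) m(1) by (auto simp: continuous_on_eq_continuous_at)
  have E: "E w = E z\<^sub>0" if "w$2 \<notin> \<int>" for w
  proof (rule invariant_constant_off_lines[OF dense])
    show "E (F z) = E z" for z using ab by (simp add: E_def u(3) c(1) m(3))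
    show "E (z + k) = E z" if "k \<in> int_lattice" for z k
      using that by (simp add: E_def u(2) c(2) m(2) int_lattice2)
    show "isCont E w"
      unfolding E_def by (intro continuous_intros uc isCont_o2[OF c(3)[OF that] mc])
  qed auto
  have y0: "(\<lambda>n. 1 / real (n + 3)) \<longlonglongrightarrow> 0"
    using LIMSEQ_ignore_initial_segment[OF lim_1_over_n, of 3] by simp
  have y: "1 / real (n + 3) \<notin> \<int>" "1 - 1 / real (n + 3) \<notin> \<int>" for n
  proof -
    have b: "0 < 1 / real (n + 3)" "1 / real (n + 3) < 1" by auto
    have *: "t \<notin> \<int>" if "0 < t" "t < 1" for t :: real
      using that by (auto elim!: Ints_cases)
    show "1 / real (n + 3) \<notin> \<int>" "1 - 1 / real (n + 3) \<notin> \<int>"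
      using b by (intro *; linarith)+
  qed
  have vlim: "(\<lambda>n. vector [x, t n] :: real^2) \<longlonglongrightarrow> vector [x, l]" if "t \<longlonglongrightarrow> l" for x l and t :: "nat \<Rightarrow> real"
  proof (rule vec_tendstoI)
    show "(\<lambda>n. (vector [x, t n] :: real^2) $ i) \<longlonglongrightarrow> vector [x, l] $ i" for i
      using exhaust_2[of i] that by auto
  qed
  have "u (vector [x, 0]) * m x = E z\<^sub>0" for x
  proof (rule LIMSEQ_unique)
    have "(\<lambda>n. E (vector [x, 1 / real (n + 3)])) \<longlonglongrightarrow> u (vector [x, 0]) * m x"
      unfolding E_def
      by (intro tendsto_mult isCont_tendsto_compose[OF uc vlim[OF y0]] isCont_tendsto_compose[OF mc boundary_values(1)[OF c(4)]])
    then show "(\<lambda>n. E z\<^sub>0) \<longlonglongrightarrow> u (vector [x, 0]) * m x" using y by (simp add: E del: of_nat_add)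
  qed simp
  moreover have "u (vector [x, 0]) * m (x + s) = E z\<^sub>0" for x
  proof (rule LIMSEQ_unique)
    have "(\<lambda>n. 1 - 1 / real (n + 3)) \<longlonglongrightarrow> 1 - 0" by (intro tendsto_intros y0)
    then have y1: "(\<lambda>n. 1 - 1 / real (n + 3)) \<longlonglongrightarrow> 1" by simp
    have "(\<lambda>n. E (vector [x, 1 - 1 / real (n + 3)])) \<longlonglongrightarrow> u (vector [x, 1]) * m (x + s)"
      unfolding E_def
      by (intro tendsto_mult isCont_tendsto_compose[OF uc vlim[OF y1]] isCont_tendsto_compose[OF mc boundary_values(2)[OF c(4)]])
    moreover have "u (vector [x, 1]) = u (vector [x, 0])"
    proof -
      have "vector [x, 1] = vector [x, 0] + (vector [0, 1] :: real^2)" by (simp add: vec_eq_iff forall_2)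
      then show ?thesis using u(2)[of "vector [0, 1]" "vector [x, 0]"] by (simp add: int_lattice2)
    qed
    ultimately show "(\<lambda>n. E z\<^sub>0) \<longlonglongrightarrow> u (vector [x, 0]) * m (x + s)" using y by (simp add: E del: of_nat_add)
  qed simp
  ultimately show ?thesis by blast
qed

section \<open>The counterexample\<close>

lemma irrational_exists: "\<exists>s::real. s \<notin> \<rat> \<and> \<bar>s\<bar> \<le> 1"
proof (rule ccontr)
  assume "\<not> ?thesis"
  then have "{0<..<1} \<subseteq> (\<rat> :: real set)" by force
  then have "countable {0<..<1::real}" using countable_rat countable_subset by blast
  then show False using uncountable_open_interval[of 0 "1::real"] by simp
qed

theorem mainTheorem3:
  "\<exists>f :: (real^2) torus \<Rightarrow> (real^2) torus.
     torus_homeo f \<and> area_preserving f \<and> transitive_map f \<and> annular f \<and>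
     irrational_pseudo_rotation_bounded_dev f \<and>
     (\<forall>\<alpha>::real. \<alpha> \<notin> \<rat> \<longrightarrow> \<not> semiconjugate f (circle_rotation \<alpha>))"
proof -
  obtain s :: real where s: "s \<notin> \<rat>" "\<bar>s\<bar> \<le> 1" using irrational_exists by blast
  obtain F G :: "real^2 \<Rightarrow> real^2" and c \<alpha> where
    hom: "homeomorphism UNIV UNIV F G" and eq: "lattice_equivariant F" and mp: "lebesgue_preserving F"
    and trans: "\<And>e. e > 0 \<Longrightarrow> eps_transitive F e"
    and cF: "\<And>z. c (F z) = c z + \<alpha>" and ck: "\<And>z k. k \<in> int_lattice \<Longrightarrow> c (z + k) = c z + k$1"
    and cc: "\<And>z. z$2 \<notin> \<int> \<Longrightarrow> isCont c z"
    and cn: "\<And>e. e > 0 \<Longrightarrow> \<exists>\<delta>>0. \<forall>z. 1/2 - \<delta> \<le> \<bar>frac (z$2) - 1/2\<bar> \<longrightarrow> \<bar>c z - strip_coord s z\<bar> < e"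
    and cb: "\<And>z. \<bar>c z - strip_coord s z\<bar> \<le> 2"
    and lines: "\<And>z. z$2 \<in> \<int> \<Longrightarrow> F z = z + vector [\<alpha>, 0]"
    and strip: "\<And>z j. of_int j \<le> z$2 \<Longrightarrow> z$2 \<le> of_int j + 1 \<Longrightarrow> of_int j \<le> F z $ 2 \<and> F z $ 2 \<le> of_int j + 1"
    by (rule limit_map[OF s(2)]) blast
  have contF: "continuous_on UNIV F" using hom by (simp add: homeomorphism_def)
  obtain z\<^sub>0 where dense: "\<And>w e. 0 < e \<Longrightarrow> \<exists>j. \<exists>k\<in>int_lattice. dist ((F ^^ j) z\<^sub>0 + k) w < e"
    using dense_orbit_exists[OF eq contF trans] by blast
  have rigid: "\<exists>e. \<forall>x. u (vector [x, 0]) * m x = e \<and> u (vector [x, 0]) * m (x + s) = e"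
    if "continuous_on UNIV u" "\<And>z k. k \<in> int_lattice \<Longrightarrow> u (z + k) = u z" "\<And>z. u (F z) = a * u z"
      "continuous_on UNIV m" "\<And>t k. k \<in> \<int> \<Longrightarrow> m (t + k) = m t" "\<And>t. m (t + \<alpha>) = b * m t" "a * b = 1"
    for u :: "real^2 \<Rightarrow> complex" and m a b
    by (rule boundary_rigidity[of F z\<^sub>0 c \<alpha> s u a m b]) (use dense cF ck cc cn that in blast)+
  have \<alpha>: "\<alpha> \<notin> \<rat>"
  proof
    assume "\<alpha> \<in> \<rat>"
    then obtain p b :: int where pb: "b > 0" "\<alpha> = of_int p / of_int b" by (auto elim: Rats_cases')
    \<comment> \<open>for rational \<open>\<alpha>\<close> with denominator \<open>b\<close>, a nonconstant function invariant under the translation by \<open>\<alpha>\<close>\<close>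
    define m where "m = (\<lambda>t. cis (2 * pi * (of_int b * t)))"
    have m1: "continuous_on UNIV m" unfolding m_def cis_conv_exp by (intro continuous_intros)
    have m2: "m (t + k) = m t" if "k \<in> \<int>" for t k
      using cis_2pi_Ints[of "of_int b * k" "of_int b * t"] that by (simp add: m_def distrib_left)
    have m3: "m (t + \<alpha>) = 1 * m t" for t
    proof -
      have "of_int b * (t + \<alpha>) = of_int b * t + of_int p" using pb by (simp add: field_simps)
      then show ?thesis using cis_2pi_Ints[of "of_int p" "of_int b * t"] by (simp only: m_def) simp
    qed
    have "\<exists>e. \<forall>x. 1 * m x = e \<and> 1 * m (x + s) = e"
      by (rule rigid[of "\<lambda>_. 1" 1 m 1]) (auto simp: m1 m2 m3)
    then have "m 0 = m (1 / (2 * of_int b))" by (metis mult_1)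
    then show False using pb(1) by (simp add: m_def)
  qed
  define f where "f = torus_map F"
  have lift: "lift_of f F" unfolding f_def by (rule lift_of_torus_map[OF eq hom])
  have c1: "c ((F ^^ n) z) = c z + real n * \<alpha>" for n z
    by (induction n) (simp_all add: cF algebra_simps)
  have d1: "\<bar>((F ^^ n) z) $ 1 - z$1 - real n * \<alpha>\<bar> \<le> 6" for n z
  proof -
    have "\<bar>c z - z$1\<bar> \<le> 3" for z
    proof -
      have "\<bar>s * frac (z$2)\<bar> \<le> 1 * 1"
        unfolding abs_mult using s(2) frac_lt_1[of "z$2"] by (intro mult_mono) (auto simp: less_imp_le)
      then show ?thesis using cb[of z] by (simp add: strip_coord_def)
    qed
    from this[of z] this[of "(F ^^ n) z"] show ?thesis by (simp add: c1)
  qed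
  have d2: "\<bar>((F ^^ n) z) $ 2 - z$2\<bar> \<le> 1" for n z
  proof -
    have "of_int \<lfloor>z$2\<rfloor> \<le> (F ^^ n) z $ 2 \<and> (F ^^ n) z $ 2 \<le> of_int \<lfloor>z$2\<rfloor> + 1"
    proof (induction n)
      case 0 show ?case by (simp add: less_imp_le)
    next
      case (Suc n) then show ?case using strip[of "\<lfloor>z$2\<rfloor>" "(F ^^ n) z"] by simp
    qed
    then show ?thesis by linarith
  qed
  have "torus_homeo f"
    unfolding torus_homeo_def f_def using homeomorphism_torus_map[OF eq hom] by blast
  moreover have "area_preserving f"
    unfolding f_def by (rule area_preserving_torus_map[OF eq hom mp])
  moreover have "transitive_map f"
    unfolding f_def by (rule transitive_torus_map[OF eq dense])
  moreover have "annular f"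
    unfolding annular_def
  proof (intro exI conjI allI)
    show "(2::real) > 0" by simp
    show "(vector [0, 1] :: real^2) \<in> int_lattice" by (simp add: int_lattice2)
    show "(vector [0, 1] :: real^2) \<noteq> 0" by (simp add: vec_eq_iff forall_2)
    show "\<bar>((F ^^ n) x - x) \<bullet> vector [0, 1]\<bar> < 2" for x n
      using d2[of n x] by (simp add: inner_vec_def sum_2)
  qed (rule lift)
  moreover have "irrational_pseudo_rotation_bounded_dev f"
    unfolding irrational_pseudo_rotation_bounded_dev_def pseudo_rotation_bounded_dev_def
  proof (intro exI conjI allI)
    show "homotopic_with_canon (\<lambda>_. True) UNIV UNIV id f"
      unfolding f_def by (rule homotopic_id_torus_map[OF eq contF])
    show "(7::real) > 0" by simp
    show "norm ((F ^^ n) z - z - real n *\<^sub>R vector [\<alpha>, 0]) \<le> 7" for n z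
      using norm_vec2_le[of "(F ^^ n) z - z - real n *\<^sub>R vector [\<alpha>, 0]"] d1[of n z] d2[of n z] by simp
    show "(vector [\<alpha>, 0] :: real^2) \<notin> rat_vectors"
      using \<alpha> by (auto simp: rat_vectors_def Basis_vec_def inner_axis intro!: exI[of _ 1])
  qed (rule lift)
  moreover have "\<not> semiconjugate f (circle_rotation \<beta>)" if \<beta>: "\<beta> \<notin> \<rat>" for \<beta> :: real
  proof
    assume "semiconjugate f (circle_rotation \<beta>)"
    then obtain h where h: "continuous_on UNIV h" "h \<circ> f = circle_rotation \<beta> \<circ> h"
      unfolding semiconjugate_def by blast
    define u where "u = (\<lambda>z. circle_char (h (torus_proj z)))"
    have uc: "continuous_on UNIV u"
      unfolding u_def
      by (intro continuous_on_compose2[OF continuous_circle_char]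
          continuous_on_compose2[OF h(1)] continuous_on_torus_proj) auto
    have uk: "u (z + k) = u z" if "k \<in> int_lattice" for z k
      by (simp add: u_def torus_proj_add_lattice[OF that])
    have uF: "u (F z) = cis (2 * pi * \<beta>) * u z" for z
      using fun_cong[OF h(2), of "torus_proj z"]
      by (simp add: u_def f_def torus_map_proj[OF eq] circle_char_rotation)
    have un: "u z * cnj (u z) = 1" for z
      using complex_norm_square[of "u z"] by (simp add: u_def norm_circle_char)
    \<comment> \<open>the restriction to the invariant circle, where \<open>F\<close> is the rotation by \<open>\<alpha>\<close>\<close>
    define v where "v = (\<lambda>x. u (vector [x, 0]))"
    have vc: "continuous_on UNIV v"
    proof -
      have "(vector [x, 0] :: real^2) = x *\<^sub>R vector [1, 0]" for x by (simp add: vec_eq_iff forall_2)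
      then have "v = (\<lambda>x. u (x *\<^sub>R vector [1, 0]))" unfolding v_def by metis
      moreover have "continuous_on UNIV (\<lambda>x. u (x *\<^sub>R vector [1, 0]))"
        by (rule continuous_on_compose2[OF uc]) (auto intro!: continuous_intros)
      ultimately show ?thesis by simp
    qed
    have vk: "v (x + k) = v x" if "k \<in> \<int>" for x k
      using uk[of "vector [k, 0]" "vector [x, 0]"] that by (simp add: v_def vector_add_1 int_lattice2)
    have v\<alpha>: "v (x + \<alpha>) = cis (2 * pi * \<beta>) * v x" for x
      using uF[of "vector [x, 0]"] by (simp add: v_def lines vector_add_1)
    have "\<exists>e. \<forall>x. u (vector [x, 0]) * cnj (v x) = e \<and> u (vector [x, 0]) * cnj (v (x + s)) = e"
      by (rule rigid[OF uc uk uF, of "\<lambda>x. cnj (v x)" "cnj (cis (2 * pi * \<beta>))"])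
         (auto intro!: continuous_intros vc simp: vk v\<alpha> cis_cnj cis_mult)
    then have eq_s: "v x * cnj (v x) = v x * cnj (v (x + s))" for x by (metis v_def)
    have vs: "v (x + s) = v x" for x
    proof -
      have "v x \<noteq> 0" using un[of "vector [x, 0]"] by (auto simp: v_def)
      then show ?thesis using eq_s[of x] by simp
    qed
    \<comment> \<open>the multiples of the irrational number \<open>s\<close> are dense modulo \<open>1\<close>, so \<open>v\<close> is constant\<close>
    have vn: "v (real n * s) = v 0" for n
      by (induction n) (auto simp: vs distrib_right add.commute[of s])
    have vfrac: "v (frac x) = v x" for x
      using vk[of "- of_int \<lfloor>x\<rfloor>" x] by (simp add: frac_def)
    have "closed (v -` {v 0})" using vc by (intro closed_vimage) auto
    moreover have "range (\<lambda>n. frac (real n * s)) \<subseteq> v -` {v 0}" by (auto simp: vfrac vn)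
    ultimately have "closure (range (\<lambda>n. frac (real n * s))) \<subseteq> v -` {v 0}" by (rule closure_minimal[rotated])
    then have "v (frac \<alpha>) = v 0"
      unfolding Kronecker_approx_1[OF s(1)] using frac_lt_1[of \<alpha>] frac_ge_0[of \<alpha>]
      by (meson atLeastAtMost_iff less_imp_le singletonD subsetD vimageD)
    then have "cis (2 * pi * \<beta>) * v 0 = v 0" using v\<alpha>[of 0] vfrac[of \<alpha>] by simp
    moreover have "v 0 \<noteq> 0" using un[of "vector [0, 0]"] by (auto simp: v_def)
    ultimately have "cis (2 * pi * \<beta>) = 1" by simp
    then have "cos (2 * pi * \<beta>) = 1" by (simp add: complex_eq_iff)
    then obtain i :: int where "2 * pi * \<beta> = of_int i * 2 * pi" using cos_one_2pi_int by blast
    then have "\<beta> = of_int i" by simp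
    then show False using \<beta> by simp
  qed
  ultimately show ?thesis by blast
qed

end
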